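(* Let $0<T<\infty$. The reproducing kernel Hilbert space $\mathcal H_T(K_r)$ associated with the kernel $K_r(t,s)$, $t,s\in[-T,T]$, consists of the functions of the form $$F(t)=\int_{\mathbb R}\frac{e^{itu}-1}{iu}\,f(u)\,d\sigma(u),\qquad t\in[-T,T],\quad f\in\mathscr M_T,$$ with norm $\|F\|_{\mathcal H_T(K_r)}=\|f\|_{\mathbf L_2(d\sigma)}$. Moreover, if $F$ is extended to all $t\in\mathbb R$ by the same formula, then $F$ defines a tempered distribution on $\mathbb R$ and $$F'=2\pi\,(f\,d\sigma)^{\vee}$$ in the sense of distributions, where $(f\,d\sigma)^{\vee}$ is the inverse Fourier transform of the tempered distribution defined by $f\,d\sigma$.
   Context: $\sigma$ is an increasing right-continuous function on $\mathbb R$, and $d\sigma$ is the associated positive measure, assumed to satisfy $\int_{\mathbb R}\frac{d\sigma(u)}{u^2+1}<\infty$. The function $r$ is $$r(t)=r_0+i\gamma t-\int_{\mathbb R}\Big\{e^{itu}-1-\frac{itu}{u^2+1}\Big\}\frac{d\sigma(u)}{u^2},\qquad t\in\mathbb R,$$ with $r_0=r(0)$ and $\gamma$ real, and (with $*$ denoting complex conjugation) $$K_r(t,s)=r(t)+r(s)^*-r(t-s)-r(0)=\int_{\mathbb R}\frac{e^{itu}-1}{u}\,\frac{e^{-isu}-1}{u}\,d\sigma(u).$$ All integrands are extended to $u=0$ by continuity. For $t\in\mathbb R$ let $\chi_t(u)=\frac{e^{itu}-1}{iu}$ (with $\chi_t(0)=t$). $\mathscr M_T$ denotes the closed linear span in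 $\mathbf L_2(d\sigma)$ of the functions $\chi_t$, $|t|\le T$. The Fourier transform is $\widehat f(u)=\int_{\mathbb R}e^{-iux}f(x)\,dx$ and the inverse transform is $f^{\vee}(u)=\frac1{2\pi}\int_{\mathbb R}e^{iux}f(x)\,dx$; on tempered distributions $\psi$, $\langle\psi^{\vee},\varphi\rangle=\langle\psi,\varphi^{\vee}\rangle$ for Schwartz $\varphi$ (bilinear duality). *)

theory Defs
  imports "HOL-Analysis.Analysis"
begin

section \<open>Reproducing kernel Hilbert spaces of complex-valued functions\<close>

definition ip_norm :: "(('a \<Rightarrow> complex) \<Rightarrow> ('a \<Rightarrow> complex) \<Rightarrow> complex) \<Rightarrow> ('a \<Rightarrow> complex) \<Rightarrow> real"
  where "ip_norm ip F = sqrt (Re (ip F F))"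

text \<open>
  A function on \<open>X\<close> is represented by its extensional representative (\<open>undefined\<close> outside \<open>X\<close>),
  so the vector space operations are pointwise operations restricted to \<open>X\<close>.
  The inner product is linear in the first argument; its values outside \<open>H\<close> are irrelevant.
\<close>

locale function_hilbert_space =
  fixes X :: "'a set"
    and H :: "('a \<Rightarrow> complex) set"
    and ip :: "('a \<Rightarrow> complex) \<Rightarrow> ('a \<Rightarrow> complex) \<Rightarrow> complex"
  assumes functions_on: "H \<subseteq> extensional X"
    and zero_mem: "(\<lambda>x\<in>X. 0) \<in> H"
    and add_mem: "F \<in> H \<Longrightarrow> G \<in> H \<Longrightarrow> (\<lambda>x\<in>X. F x + G x) \<in> H"
    and scale_mem: "F \<in> H \<Longrightarrow> (\<lambda>x\<in>X. c * F x) \<in> H"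
    and ip_add_left: "F \<in> H \<Longrightarrow> G \<in> H \<Longrightarrow> L \<in> H \<Longrightarrow> ip (\<lambda>x\<in>X. F x + G x) L = ip F L + ip G L"
    and ip_scale_left: "F \<in> H \<Longrightarrow> G \<in> H \<Longrightarrow> ip (\<lambda>x\<in>X. c * F x) G = c * ip F G"
    and ip_commute: "F \<in> H \<Longrightarrow> G \<in> H \<Longrightarrow> ip G F = cnj (ip F G)"
    and ip_nonneg: "F \<in> H \<Longrightarrow> 0 \<le> Re (ip F F)"
    and ip_definite: "F \<in> H \<Longrightarrow> ip F F = 0 \<Longrightarrow> F = (\<lambda>x\<in>X. 0)"
    and ip_complete:
      "\<lbrakk>\<And>n. Fs n \<in> H;
        \<And>\<epsilon>. \<epsilon> > 0 \<Longrightarrow> \<exists>N::nat. \<forall>m\<ge>N. \<forall>n\<ge>N. ip_norm ip (\<lambda>x\<in>X. Fs m x - Fs n x) < \<epsilon>\<rbrakk>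
       \<Longrightarrow> \<exists>F\<in>H. (\<lambda>n. ip_norm ip (\<lambda>x\<in>X. Fs n x - F x)) \<longlonglongrightarrow> 0"

locale rkhs = function_hilbert_space X H ip
  for X :: "'a set" and H ip +
  fixes K :: "'a \<Rightarrow> 'a \<Rightarrow> complex"
  assumes kernel_mem: "y \<in> X \<Longrightarrow> (\<lambda>x\<in>X. K x y) \<in> H"
    and reproducing: "F \<in> H \<Longrightarrow> y \<in> X \<Longrightarrow> F y = ip F (\<lambda>x\<in>X. K x y)"

section \<open>The space of square integrable functions and closed linear spans\<close>

text \<open>
  Elements are functions rather than classes modulo almost everywhere equality, so
  \<open>L2_norm M\<close> is a seminorm, and closed linear spans are closed under changes on null sets.
\<close>

definition L2_space :: "'a measure \<Rightarrow> ('a \<Rightarrow> complex) set" where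
  "L2_space M = {f \<in> borel_measurable M. integrable M (\<lambda>u. (cmod (f u))\<^sup>2)}"

definition L2_norm :: "'a measure \<Rightarrow> ('a \<Rightarrow> complex) \<Rightarrow> real" where
  "L2_norm M f = sqrt (\<integral>u. (cmod (f u))\<^sup>2 \<partial>M)"

definition fun_span :: "('a \<Rightarrow> complex) set \<Rightarrow> ('a \<Rightarrow> complex) set" where
  "fun_span S = {\<lambda>u. \<Sum>g\<in>A. c g * g u | A c. finite A \<and> A \<subseteq> S}"

definition L2_closed_span :: "'a measure \<Rightarrow> ('a \<Rightarrow> complex) set \<Rightarrow> ('a \<Rightarrow> complex) set" where
  "L2_closed_span M S =
     {f \<in> L2_space M. \<forall>\<epsilon>>0. \<exists>g\<in>fun_span S. L2_norm M (\<lambda>u. f u - g u) < \<epsilon>}"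

section \<open>The kernel\<close>

text \<open>
  The value of the integrand at \<open>u = 0\<close> is its limit, since
  \<open>exp (itu) - 1 - itu/(u\<^sup>2 + 1) = - t\<^sup>2u\<^sup>2/2 + O(u\<^sup>3)\<close>.
\<close>

definition r_integrand :: "real \<Rightarrow> real \<Rightarrow> complex" where
  "r_integrand t u =
     (if u = 0 then - (of_real t)\<^sup>2 / 2
      else (exp (\<i> * of_real t * of_real u) - 1
              - \<i> * of_real t * of_real u / ((of_real u)\<^sup>2 + 1)) / (of_real u)\<^sup>2)"

definition r_fun :: "(real \<Rightarrow> real) \<Rightarrow> real \<Rightarrow> real \<Rightarrow> real \<Rightarrow> complex" where
  "r_fun \<sigma> r\<^sub>0 \<gamma> t =
     of_real r\<^sub>0 + \<i> * of_real \<gamma> * of_real t - (\<integral>u. r_integrand t u \<partial>interval_measure \<sigma>)"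

definition kernel_of :: "(real \<Rightarrow> complex) \<Rightarrow> real \<Rightarrow> real \<Rightarrow> complex" where
  "kernel_of r t s = r t + cnj (r s) - r (t - s) - r 0"

definition chi :: "real \<Rightarrow> real \<Rightarrow> complex" where
  "chi t u = (if u = 0 then of_real t
              else (exp (\<i> * of_real t * of_real u) - 1) / (\<i> * of_real u))"

definition chi_span :: "(real \<Rightarrow> real) \<Rightarrow> real \<Rightarrow> (real \<Rightarrow> complex) set" where
  "chi_span \<sigma> T = L2_closed_span (interval_measure \<sigma>) {chi t | t. \<bar>t\<bar> \<le> T}"

definition chi_transform :: "(real \<Rightarrow> real) \<Rightarrow> (real \<Rightarrow> complex) \<Rightarrow> real \<Rightarrow> complex" where
  "chi_transform \<sigma> f t = (\<integral>u. chi t u * f u \<partial>interval_measure \<sigma>)"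

section \<open>Schwartz functions and tempered distributions on the real line\<close>

definition vderiv :: "(real \<Rightarrow> complex) \<Rightarrow> real \<Rightarrow> complex" where
  "vderiv \<phi> = (\<lambda>x. vector_derivative \<phi> (at x))"

definition schwartz :: "(real \<Rightarrow> complex) set" where
  "schwartz = {\<phi>. (\<forall>n x. (vderiv ^^ n) \<phi> differentiable (at x)) \<and>
                  (\<forall>k n. bounded (range (\<lambda>x. \<bar>x\<bar> ^ k * cmod ((vderiv ^^ n) \<phi> x))))}"

definition schwartz_seminorm :: "nat \<Rightarrow> nat \<Rightarrow> (real \<Rightarrow> complex) \<Rightarrow> real" where
  "schwartz_seminorm k n \<phi> = (SUP x. \<bar>x\<bar> ^ k * cmod ((vderiv ^^ n) \<phi> x))"

definition schwartz_topology :: "(real \<Rightarrow> complex) topology" where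
  "schwartz_topology = topology_generated_by
     {{\<eta> \<in> schwartz. schwartz_seminorm k n (\<lambda>x. \<eta> x - \<phi> x) < \<epsilon>} | k n \<phi> \<epsilon>.
        \<phi> \<in> schwartz \<and> 0 < \<epsilon>}"

text \<open>
  Distributions are functionals on all functions; only their values on \<^const>\<open>schwartz\<close> matter,
  and two of them are equal as distributions when they agree there.
\<close>

definition tempered_distribution :: "((real \<Rightarrow> complex) \<Rightarrow> complex) \<Rightarrow> bool" where
  "tempered_distribution \<psi> \<longleftrightarrow>
     (\<forall>\<phi>\<in>schwartz. \<forall>\<eta>\<in>schwartz. \<psi> (\<lambda>x. \<phi> x + \<eta> x) = \<psi> \<phi> + \<psi> \<eta>) \<and>
     (\<forall>\<phi>\<in>schwartz. \<forall>c. \<psi> (\<lambda>x. c * \<phi> x) = c * \<psi> \<phi>) \<and>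
     continuous_map schwartz_topology euclidean \<psi>"

text \<open>The pairing with \<open>f dM\<close>; a function \<open>F\<close> on the line is identified with \<open>F(t) dt\<close>.\<close>

definition dist_of :: "real measure \<Rightarrow> (real \<Rightarrow> complex) \<Rightarrow> (real \<Rightarrow> complex) \<Rightarrow> complex" where
  "dist_of M f \<phi> = (\<integral>x. f x * \<phi> x \<partial>M)"

definition defines_tempered_distribution :: "real measure \<Rightarrow> (real \<Rightarrow> complex) \<Rightarrow> bool" where
  "defines_tempered_distribution M f \<longleftrightarrow>
     (\<forall>\<phi>\<in>schwartz. integrable M (\<lambda>x. f x * \<phi> x)) \<and> tempered_distribution (dist_of M f)"

definition dist_deriv :: "((real \<Rightarrow> complex) \<Rightarrow> complex) \<Rightarrow> (real \<Rightarrow> complex) \<Rightarrow> complex" where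
  "dist_deriv \<psi> \<phi> = - \<psi> (vderiv \<phi>)"

definition inv_fourier :: "(real \<Rightarrow> complex) \<Rightarrow> real \<Rightarrow> complex" where
  "inv_fourier \<phi> u = 1 / (2 * of_real pi) * (\<integral>x. exp (\<i> * of_real u * of_real x) * \<phi> x \<partial>lborel)"

definition dist_inv_fourier :: "((real \<Rightarrow> complex) \<Rightarrow> complex) \<Rightarrow> (real \<Rightarrow> complex) \<Rightarrow> complex" where
  "dist_inv_fourier \<psi> \<phi> = \<psi> (inv_fourier \<phi>)"

end

theory Submission
  imports Defs "HOL-Probability.Characteristic_Functions" "HOL-Real_Asymp.Real_Asymp"
begin

text \<open>
  The kernel is a Gram kernel. Subtracting the integrals in \<open>r\<close> term by term, the linear corrections
  cancel and what remains is \<open>K(t, s) = \<integral> chi t * cnj (chi s) d\<sigma>\<close> (\<open>kernel_of_r_fun\<close>), that is, the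
  Gram kernel of the square integrable functions \<open>k s = cnj (chi s)\<close>. For any such family
  the functions \<open>x \<mapsto> \<langle>f, k x\<rangle>\<close>, with \<open>f\<close> in the closed linear span of the family and with the
  norm of \<open>f\<close>, form a reproducing kernel Hilbert space for the Gram kernel (\<open>feature_map_rkhs\<close>):
  the transform is injective on the closed span modulo null sets, because an \<open>f\<close> with zero transform
  is orthogonal to the family, and completeness is the Riesz--Fischer theorem (\<open>L2_complete\<close>). Since
  \<open>cnj (chi s) = - chi (- s)\<close> and the interval is symmetric, the closed span is that of the \<open>chi t\<close>.

  A reproducing kernel Hilbert space is determined by its kernel (\<open>rkhs_unique\<close>), so every space with
  this kernel is the one just described. Indeed, the linear combinations of kernel functions are dense
  because a function orthogonal to all of them vanishes at every point, their norms can be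
  read off from the kernel, and limits in the norm are limits at every point.

  For the derivative, \<open>|chi t u| \<le> (|t| + 2) / sqrt (u\<^sup>2 + 1)\<close> separates the two variables. By
  \<open>|f| / sqrt (u\<^sup>2 + 1) \<le> |f|\<^sup>2 + 1 / (u\<^sup>2 + 1)\<close>, \<open>f\<close> times the second factor is integrable against \<open>d\<sigma>\<close>. Hence
  the transform \<open>F\<close> grows at most linearly, so that it is a tempered distribution, and in \<open>- \<integral> F \<phi>' dt\<close>
  the order of integration may be exchanged. As \<open>chi t u\<close> is a primitive of \<open>exp (i u t)\<close> in \<open>t\<close>,
  integrating by parts in the inner integral leaves \<open>\<integral> exp (i u t) \<phi> t dt\<close>, which is \<open>2 * pi\<close> times the
  inverse Fourier transform of \<open>\<phi>\<close> (\<open>chi_transform_deriv\<close>).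
\<close>

section \<open>Inner product spaces of functions\<close>

text \<open>
  Operations restricted to \<open>X\<close> keep the values \<open>undefined\<close> outside \<open>X\<close>; for \<open>X = UNIV\<close> this is the
  ordinary linear combination. So one theory of inner products serves both the spaces of functions
  on \<open>X\<close> and the space of square integrable functions.
\<close>

definition lincomb :: "'a set \<Rightarrow> complex \<Rightarrow> ('a \<Rightarrow> complex) \<Rightarrow> complex \<Rightarrow> ('a \<Rightarrow> complex) \<Rightarrow> 'a \<Rightarrow> complex"
  where "lincomb X a F b G = (\<lambda>x\<in>X. a * F x + b * G x)"

text \<open>
  The minimum over \<open>c\<close> is attained at \<open>c = - z / q\<close> and equals \<open>p - |z|\<^sup>2 / q\<close>; if \<open>q = 0\<close>, a large
  multiple of \<open>- z\<close> makes the expression negative unless \<open>z = 0\<close>. Applied to \<open>\<parallel>F + c G\<parallel>\<^sup>2\<close>, it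
  gives the Cauchy--Schwarz inequality; with \<open>p = 0\<close>, it gives the orthogonality of a best approximation.
\<close>

lemma discriminant_of_nonneg_quadratic:
  fixes z :: complex and p q :: real
  assumes nonneg: "\<And>c. 0 \<le> p + 2 * Re (cnj c * z) + (cmod c)\<^sup>2 * q"
    and "0 \<le> q"
  shows "(cmod z)\<^sup>2 \<le> p * q"
proof -
  have real_c: "0 \<le> p - 2 * s * (cmod z)\<^sup>2 + s\<^sup>2 * (cmod z)\<^sup>2 * q" for s :: real
  proof -
    have "Re (cnj (- of_real s * z) * z) = - s * (cmod z)\<^sup>2"
      unfolding cmod_power2 by (simp add: algebra_simps power2_eq_square)
    moreover have "(cmod (- of_real s * z))\<^sup>2 = s\<^sup>2 * (cmod z)\<^sup>2"
      by (simp add: norm_mult power_mult_distrib)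
    ultimately show ?thesis
      using nonneg[of "- of_real s * z"] by (simp only:)
  qed
  show ?thesis
  proof (cases "q = 0")
    case True
    have "(cmod z)\<^sup>2 = 0"
    proof (rule ccontr)
      assume nz: "(cmod z)\<^sup>2 \<noteq> 0"
      have "2 * ((p + 1) / (2 * (cmod z)\<^sup>2)) * (cmod z)\<^sup>2 = p + 1"
        using nz by (simp add: field_simps)
      \<comment> \<open>With this \<open>s\<close> the quadratic takes the value \<open>p - (p + 1) = - 1\<close>.\<close>
      with real_c[of "(p + 1) / (2 * (cmod z)\<^sup>2)"] True show False
        by simp
    qed
    then show ?thesis using True by simp
  next
    case False
    with \<open>0 \<le> q\<close> have "q > 0" by simp
    have "(1/q)\<^sup>2 * (cmod z)\<^sup>2 * q = (cmod z)\<^sup>2 / q"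
      using \<open>q > 0\<close> by (simp add: field_simps power2_eq_square)
    with real_c[of "1/q"] have "(cmod z)\<^sup>2 / q \<le> p"
      by simp
    then show ?thesis
      using \<open>q > 0\<close> by (simp add: field_simps)
  qed
qed

text \<open>
  The inner product may be degenerate, because square integrable functions are not
  identified when they agree almost everywhere.
\<close>

locale semi_inner_functions =
  fixes X :: "'a set"
    and H :: "('a \<Rightarrow> complex) set"
    and ip :: "('a \<Rightarrow> complex) \<Rightarrow> ('a \<Rightarrow> complex) \<Rightarrow> complex"
  assumes lincomb_mem: "F \<in> H \<Longrightarrow> G \<in> H \<Longrightarrow> lincomb X a F b G \<in> H"
    and ip_lincomb_left: "F \<in> H \<Longrightarrow> G \<in> H \<Longrightarrow> L \<in> H \<Longrightarrow>
      ip (lincomb X a F b G) L = a * ip F L + b * ip G L"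
    and ip_commute: "F \<in> H \<Longrightarrow> G \<in> H \<Longrightarrow> ip G F = cnj (ip F G)"
    and ip_nonneg: "F \<in> H \<Longrightarrow> 0 \<le> Re (ip F F)"
begin

lemma ip_lincomb_right:
  assumes "F \<in> H" "G \<in> H" "L \<in> H"
  shows "ip L (lincomb X a F b G) = cnj a * ip L F + cnj b * ip L G"
proof -
  have "ip L (lincomb X a F b G) = cnj (ip (lincomb X a F b G) L)"
    by (rule ip_commute) (auto intro: lincomb_mem assms)
  also have "\<dots> = cnj a * cnj (ip F L) + cnj b * cnj (ip G L)"
    by (simp add: ip_lincomb_left assms)
  finally show ?thesis
    using assms ip_commute[of F L] ip_commute[of G L] by simp
qed

lemma norm_nonneg: "F \<in> H \<Longrightarrow> 0 \<le> ip_norm ip F"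
  by (simp add: ip_norm_def ip_nonneg)

lemma norm_squared: "F \<in> H \<Longrightarrow> (ip_norm ip F)\<^sup>2 = Re (ip F F)"
  by (simp add: ip_norm_def ip_nonneg)

lemma norm_squared_lincomb:
  assumes "F \<in> H" "G \<in> H"
  shows "(ip_norm ip (lincomb X a F b G))\<^sup>2 =
    (cmod a)\<^sup>2 * (ip_norm ip F)\<^sup>2 + 2 * Re (a * cnj b * ip F G) + (cmod b)\<^sup>2 * (ip_norm ip G)\<^sup>2"
proof -
  have "ip F F = of_real (Re (ip F F))" "ip G G = of_real (Re (ip G G))"
    using ip_commute[of F F] ip_commute[of G G] assms by (auto simp: complex_eq_iff)
  then have im: "Im (ip F F) = 0" "Im (ip G G) = 0"
    by (metis Im_complex_of_real)+
  have GF: "ip G F = cnj (ip F G)"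
    using assms by (rule ip_commute)
  have "(ip_norm ip (lincomb X a F b G))\<^sup>2 = Re (ip (lincomb X a F b G) (lincomb X a F b G))"
    by (simp add: norm_squared lincomb_mem assms)
  also have "ip (lincomb X a F b G) (lincomb X a F b G) =
      a * (cnj a * ip F F + cnj b * ip F G) + b * (cnj a * cnj (ip F G) + cnj b * ip G G)"
    by (simp add: ip_lincomb_left ip_lincomb_right lincomb_mem assms GF algebra_simps)
  also have "Re \<dots> = (cmod a)\<^sup>2 * Re (ip F F) + 2 * Re (a * cnj b * ip F G) + (cmod b)\<^sup>2 * Re (ip G G)"
    unfolding cmod_power2 by (simp add: im algebra_simps power2_eq_square)
  finally show ?thesis
    by (simp add: norm_squared assms)
qed

lemma cauchy_schwarz:
  assumes "F \<in> H" "G \<in> H"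
  shows "cmod (ip F G) \<le> ip_norm ip F * ip_norm ip G"
proof (rule power2_le_imp_le)
  have "(cmod (ip F G))\<^sup>2 \<le> (ip_norm ip F)\<^sup>2 * (ip_norm ip G)\<^sup>2"
  proof (rule discriminant_of_nonneg_quadratic)
    fix c
    have "0 \<le> (ip_norm ip (lincomb X 1 F c G))\<^sup>2"
      by simp
    then show "0 \<le> (ip_norm ip F)\<^sup>2 + 2 * Re (cnj c * ip F G) + (cmod c)\<^sup>2 * (ip_norm ip G)\<^sup>2"
      unfolding norm_squared_lincomb[OF assms] by simp
  qed simp
  then show "(cmod (ip F G))\<^sup>2 \<le> (ip_norm ip F * ip_norm ip G)\<^sup>2"
    by (simp add: power_mult_distrib)
qed (simp add: norm_nonneg assms)

lemma triangle:
  assumes "F \<in> H" "G \<in> H"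
  shows "ip_norm ip (lincomb X a F b G) \<le> cmod a * ip_norm ip F + cmod b * ip_norm ip G"
proof (rule power2_le_imp_le)
  have "Re (a * cnj b * ip F G) \<le> cmod (a * cnj b * ip F G)"
    by (rule complex_Re_le_cmod)
  also have "\<dots> \<le> cmod a * cmod b * (ip_norm ip F * ip_norm ip G)"
    by (simp add: norm_mult mult_left_mono cauchy_schwarz[OF assms])
  finally have "2 * Re (a * cnj b * ip F G) \<le> 2 * (cmod a * ip_norm ip F) * (cmod b * ip_norm ip G)"
    by (simp only: mult_ac)
  then show "(ip_norm ip (lincomb X a F b G))\<^sup>2 \<le> (cmod a * ip_norm ip F + cmod b * ip_norm ip G)\<^sup>2"
    unfolding norm_squared_lincomb[OF assms] power2_sum power_mult_distrib by linarith
qed (simp add: norm_nonneg assms)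

abbreviation (input) diff where "diff F G \<equiv> lincomb X 1 F (- 1) G"

lemma triangle_diff:
  assumes "F \<in> H" "G \<in> H" "L \<in> H"
  shows "ip_norm ip (diff F L) \<le> ip_norm ip (diff F G) + ip_norm ip (diff G L)"
proof -
  have "diff F L = lincomb X 1 (diff F G) 1 (diff G L)"
    by (auto simp: lincomb_def)
  then show ?thesis
    using triangle[of "diff F G" "diff G L" 1 1] assms by (simp add: lincomb_mem)
qed

lemma norm_diff_commute:
  assumes "F \<in> H" "G \<in> H"
  shows "ip_norm ip (diff F G) = ip_norm ip (diff G F)"
proof (rule power2_eq_imp_eq)
  have "ip G F = cnj (ip F G)" by (rule ip_commute[OF assms])
  then show "(ip_norm ip (diff F G))\<^sup>2 = (ip_norm ip (diff G F))\<^sup>2"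
    using assms by (simp add: norm_squared_lincomb)
qed (auto intro: norm_nonneg lincomb_mem assms)

lemma reverse_triangle:
  assumes "F \<in> H" "G \<in> H"
  shows "\<bar>ip_norm ip F - ip_norm ip G\<bar> \<le> ip_norm ip (diff F G)"
proof -
  have *: "ip_norm ip F \<le> ip_norm ip G + ip_norm ip (diff F G)" if FG: "F \<in> H" "G \<in> H" for F G
  proof (rule power2_le_imp_le)
    have "Re (ip (diff F G) G) \<le> ip_norm ip (diff F G) * ip_norm ip G"
      by (rule order_trans[OF complex_Re_le_cmod cauchy_schwarz]) (auto intro: lincomb_mem FG)
    moreover have "ip (diff F G) G = ip F G - ip G G"
      by (simp add: ip_lincomb_left FG)
    moreover have "(ip_norm ip (diff F G))\<^sup>2 = (ip_norm ip F)\<^sup>2 - 2 * Re (ip F G) + (ip_norm ip G)\<^sup>2"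
      by (simp add: norm_squared_lincomb FG)
    ultimately show "(ip_norm ip F)\<^sup>2 \<le> (ip_norm ip G + ip_norm ip (diff F G))\<^sup>2"
      by (simp add: power2_sum norm_squared[OF FG(2)] mult_ac)
  qed (simp add: norm_nonneg lincomb_mem FG)
  show ?thesis
    using *[OF assms] *[OF assms(2,1)] norm_diff_commute[OF assms] by (simp add: abs_le_iff)
qed

lemma parallelogram:
  assumes "F \<in> H" "G \<in> H" "L \<in> H"
  shows "(ip_norm ip (diff G L))\<^sup>2 + 4 * (ip_norm ip (diff F (lincomb X (1/2) G (1/2) L)))\<^sup>2
    = 2 * (ip_norm ip (diff F G))\<^sup>2 + 2 * (ip_norm ip (diff F L))\<^sup>2"
proof -
  let ?P = "diff F G" and ?Q = "diff F L"
  have *: "diff G L = diff ?Q ?P" "diff F (lincomb X (1/2) G (1/2) L) = lincomb X (1/2) ?P (1/2) ?Q"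
    by (auto simp: lincomb_def field_simps)
  have PQ: "?P \<in> H" "?Q \<in> H" by (auto intro: lincomb_mem assms)
  have c: "ip ?Q ?P = cnj (ip ?P ?Q)" by (rule ip_commute[OF PQ])
  show ?thesis
    unfolding * norm_squared_lincomb[OF PQ] norm_squared_lincomb[OF PQ(2,1)] c
    by (simp add: norm_divide power2_eq_square)
qed

end

sublocale function_hilbert_space \<subseteq> semi: semi_inner_functions X H ip
proof
  have eq: "lincomb X a F b G = (\<lambda>x\<in>X. (\<lambda>x\<in>X. a * F x) x + (\<lambda>x\<in>X. b * G x) x)" for a b F G
    by (auto simp: lincomb_def)
  show "lincomb X a F b G \<in> H" if "F \<in> H" "G \<in> H" for a b F G
    unfolding eq by (intro add_mem scale_mem that)
  show "ip (lincomb X a F b G) L = a * ip F L + b * ip G L" if "F \<in> H" "G \<in> H" "L \<in> H" for a b F G L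
    unfolding eq using that by (simp only: ip_add_left ip_scale_left scale_mem)
qed (rule ip_commute ip_nonneg, assumption+)+

section \<open>Uniqueness of the reproducing kernel Hilbert space\<close>

context function_hilbert_space
begin

text \<open>
  The projection theorem without closedness of the subspace. A sequence in \<open>S\<close> minimizing the distance
  to \<open>F\<close> is Cauchy by the parallelogram identity, since the midpoints of its members lie in \<open>S\<close> too.
  Its limit \<open>G\<close> need not lie in \<open>S\<close>, but \<open>F - G\<close> has minimal norm among all \<open>F - G + c s\<close> with \<open>s \<in> S\<close>.
  Hence \<open>F - G\<close> is orthogonal to \<open>S\<close>, and so \<open>F = G\<close>.
\<close>

lemma total_subspace_dense:
  assumes S: "S \<subseteq> H" "S \<noteq> {}"
    and S_lincomb: "\<And>F G a b. F \<in> S \<Longrightarrow> G \<in> S \<Longrightarrow> lincomb X a F b G \<in> S"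
    and total: "\<And>F. F \<in> H \<Longrightarrow> (\<And>s. s \<in> S \<Longrightarrow> ip F s = 0) \<Longrightarrow> F = (\<lambda>x\<in>X. 0)"
    and F: "F \<in> H"
  shows "\<exists>g. (\<forall>n. g n \<in> S) \<and> (\<lambda>n. ip_norm ip (lincomb X 1 F (- 1) (g n))) \<longlonglongrightarrow> 0"
proof -
  let ?N = "\<lambda>F. ip_norm ip F" and ?D = "\<lambda>F G. lincomb X 1 F (- 1) G"
  define A where "A = (\<lambda>s. (?N (?D F s))\<^sup>2) ` S"
  define d where "d = Inf A"
  have bdd: "bdd_below A" by (auto simp: A_def intro: bdd_belowI[of _ 0])
  have ne: "A \<noteq> {}" using S(2) by (simp add: A_def)
  have low: "d \<le> (?N (?D F s))\<^sup>2" if "s \<in> S" for s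
    unfolding d_def by (rule cInf_lower) (auto simp: A_def that bdd[unfolded A_def])
  have d0: "0 \<le> d"
    unfolding d_def by (rule cInf_greatest[OF ne]) (auto simp: A_def)
  have "\<exists>s\<in>S. (?N (?D F s))\<^sup>2 < d + inverse (real (Suc n))" for n
  proof -
    have "\<exists>a\<in>A. a < d + inverse (real (Suc n))"
      using cInf_lessD[OF ne] unfolding d_def by (metis less_add_same_cancel1 inverse_Suc)
    then show ?thesis by (auto simp: A_def)
  qed
  then obtain g where gS: "\<And>n. g n \<in> S" and g: "\<And>n. (?N (?D F (g n)))\<^sup>2 < d + inverse (real (Suc n))"
    by metis
  have gH: "g n \<in> H" for n using gS S by blast
  have DH: "?D a b \<in> H" if "a \<in> H" "b \<in> H" for a b
    using that by (rule semi.lincomb_mem)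
  have sub: "(\<lambda>x\<in>X. a x - b x) = ?D a b" for a b :: "'a \<Rightarrow> complex"
    by (auto simp: lincomb_def)
  have dist: "(?N (?D (g m) (g n)))\<^sup>2 < 2 * inverse (real (Suc m)) + 2 * inverse (real (Suc n))" for m n
    using semi.parallelogram[OF F gH[of m] gH[of n]] g[of m] g[of n]
      low[OF S_lincomb[OF gS[of m] gS[of n], of "1/2" "1/2"]] by linarith
  have "\<exists>G\<in>H. (\<lambda>n. ?N (\<lambda>x\<in>X. g n x - G x)) \<longlonglongrightarrow> 0"
  proof (rule ip_complete[OF gH])
    fix e :: real assume "e > 0"
    then have "0 < e\<^sup>2 / 4" by simp
    then obtain N where N: "inverse (real (Suc N)) < e\<^sup>2 / 4"
      using reals_Archimedean by blast
    have "?N (\<lambda>x\<in>X. g m x - g n x) < e" if "m \<ge> N" "n \<ge> N" for m n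
    proof -
      have "inverse (real (Suc m)) \<le> inverse (real (Suc N))" "inverse (real (Suc n)) \<le> inverse (real (Suc N))"
        using that by (auto intro!: le_imp_inverse_le)
      then have "(?N (?D (g m) (g n)))\<^sup>2 < e\<^sup>2"
        using dist[of m n] N by linarith
      then show ?thesis
        unfolding sub using \<open>e > 0\<close> by (simp add: power_less_imp_less_base)
    qed
    then show "\<exists>N. \<forall>m\<ge>N. \<forall>n\<ge>N. ?N (\<lambda>x\<in>X. g m x - g n x) < e" by blast
  qed
  then obtain G where G: "G \<in> H" and lim: "(\<lambda>n. ?N (?D (g n) G)) \<longlonglongrightarrow> 0"
    unfolding sub by blast
  have lim': "(\<lambda>n. ?N (?D G (g n))) \<longlonglongrightarrow> 0"
    using lim by (simp add: semi.norm_diff_commute[OF G gH])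
  let ?E = "?D F G"
  have E: "?E \<in> H" by (rule DH[OF F G])
  have E_upper: "?N ?E \<le> sqrt d"
  proof (rule LIMSEQ_le_const)
    show "(\<lambda>n. sqrt (d + inverse (real (Suc n))) + ?N (?D (g n) G)) \<longlonglongrightarrow> sqrt d"
      using tendsto_add[OF tendsto_real_sqrt[OF tendsto_add[OF tendsto_const[of d] LIMSEQ_inverse_real_of_nat]] lim]
      by simp
    have "?N ?E \<le> sqrt (d + inverse (real (Suc n))) + ?N (?D (g n) G)" for n
      using semi.triangle_diff[OF F gH[of n] G] real_le_rsqrt[OF less_imp_le[OF g[of n]]] by linarith
    then show "\<exists>N. \<forall>n\<ge>N. ?N ?E \<le> sqrt (d + inverse (real (Suc n))) + ?N (?D (g n) G)"
      by blast
  qed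
  have E_lower: "sqrt d \<le> ?N (lincomb X 1 ?E c s)" if s: "s \<in> S" for c s
  proof -
    have sH: "s \<in> H" using s S by blast
    have "sqrt d \<le> ?N (lincomb X 1 ?E c s) + ?N (?D G (g n))" for n
    proof -
      have "?D F (lincomb X 1 (g n) (- c) s) = lincomb X 1 (lincomb X 1 ?E c s) 1 (?D G (g n))"
        by (auto simp: lincomb_def algebra_simps)
      then have "?N (?D F (lincomb X 1 (g n) (- c) s)) \<le> ?N (lincomb X 1 ?E c s) + ?N (?D G (g n))"
        using semi.triangle[of "lincomb X 1 ?E c s" "?D G (g n)" 1 1] 
        by (simp add: semi.lincomb_mem E sH G gH)
      moreover have "sqrt d \<le> ?N (?D F (lincomb X 1 (g n) (- c) s))"
        by (rule real_le_lsqrt) (auto intro!: low S_lincomb gS s semi.norm_nonneg semi.lincomb_mem F gH sH d0)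
      ultimately show ?thesis by linarith
    qed
    then show ?thesis
      using LIMSEQ_le_const[OF tendsto_add[OF tendsto_const lim', of "?N (lincomb X 1 ?E c s)"], of "sqrt d"]
      by auto
  qed
  have "?E = (\<lambda>x\<in>X. 0)"
  proof (rule total[OF E])
    fix s assume s: "s \<in> S"
    then have sH: "s \<in> H" using S by blast
    have "(cmod (ip ?E s))\<^sup>2 \<le> 0 * (?N s)\<^sup>2"
    proof (rule discriminant_of_nonneg_quadratic)
      fix c
      have "?N ?E \<le> ?N (lincomb X 1 ?E c s)"
        using E_upper E_lower[OF s] by (rule order_trans)
      then have "(?N ?E)\<^sup>2 \<le> (?N (lincomb X 1 ?E c s))\<^sup>2"
        by (rule power_mono) (rule semi.norm_nonneg[OF E])
      then show "0 \<le> 0 + 2 * Re (cnj c * ip ?E s) + (cmod c)\<^sup>2 * (?N s)\<^sup>2"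
        unfolding semi.norm_squared_lincomb[OF E sH] by simp
    qed simp
    then show "ip ?E s = 0" by simp
  qed
  then have "F x = G x" if "x \<in> X" for x
    using that by (auto simp: lincomb_def fun_eq_iff split: if_splits)
  then have "?D F (g n) = ?D G (g n)" for n
    by (auto simp: lincomb_def)
  with lim' gS show ?thesis by (intro exI[of _ g]) simp
qed

end

inductive_set kernel_span :: "'a set \<Rightarrow> ('a \<Rightarrow> 'a \<Rightarrow> complex) \<Rightarrow> ('a \<Rightarrow> complex) set"
  for X K where
  zero: "(\<lambda>x\<in>X. 0) \<in> kernel_span X K"
| kernel: "y \<in> X \<Longrightarrow> (\<lambda>x\<in>X. K x y) \<in> kernel_span X K"
| lincomb: "F \<in> kernel_span X K \<Longrightarrow> G \<in> kernel_span X K \<Longrightarrow> lincomb X a F b G \<in> kernel_span X K"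

context rkhs
begin

lemma kernel_span_subset: "G \<in> kernel_span X K \<Longrightarrow> G \<in> H"
  by (induction rule: kernel_span.induct) (rule zero_mem kernel_mem semi.lincomb_mem, assumption?)+

lemma ip_zero_right: "F \<in> H \<Longrightarrow> ip F (\<lambda>x\<in>X. 0) = 0"
proof -
  assume F: "F \<in> H"
  have "(\<lambda>x\<in>X. 0) = lincomb X 0 F 0 F" by (auto simp: lincomb_def)
  then show ?thesis using semi.ip_lincomb_right[OF F F F, of 0 0] by simp
qed

lemma dense_kernel_span:
  assumes "F \<in> H"
  shows "\<exists>g. (\<forall>n. g n \<in> kernel_span X K) \<and> (\<lambda>n. ip_norm ip (lincomb X 1 F (- 1) (g n))) \<longlonglongrightarrow> 0"
proof (rule total_subspace_dense[OF _ _ _ _ assms])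
  fix F assume F: "F \<in> H" and ort: "\<And>s. s \<in> kernel_span X K \<Longrightarrow> ip F s = 0"
  have "F y = 0" if "y \<in> X" for y
    using reproducing[OF F that] ort[OF kernel_span.kernel[OF that]] by simp
  moreover have "F \<in> extensional X" using F functions_on by blast
  ultimately show "F = (\<lambda>x\<in>X. 0)" by (auto simp: extensional_def fun_eq_iff)
qed (auto intro: kernel_span_subset kernel_span.intros)

text \<open>
  Evaluation at a point is a continuous functional, so that limits in norm determine the limit function.
\<close>

lemma pointwise_bound:
  assumes "F \<in> H" "y \<in> X"
  shows "cmod (F y) \<le> ip_norm ip F * ip_norm ip (\<lambda>x\<in>X. K x y)"
  using semi.cauchy_schwarz[OF assms(1) kernel_mem[OF assms(2)]] reproducing[OF assms] by simp

lemma pointwise_limit: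
  assumes F: "F \<in> H" and g: "\<And>n. g n \<in> H" and y: "y \<in> X"
    and lim: "(\<lambda>n. ip_norm ip (lincomb X 1 F (- 1) (g n))) \<longlonglongrightarrow> 0"
  shows "(\<lambda>n. g n y) \<longlonglongrightarrow> F y"
proof -
  have "(\<lambda>n. F y - g n y) \<longlonglongrightarrow> 0"
  proof (rule Lim_null_comparison)
    have "cmod (F y - g n y) \<le> ip_norm ip (lincomb X 1 F (- 1) (g n)) * ip_norm ip (\<lambda>x\<in>X. K x y)" for n
      using pointwise_bound[OF semi.lincomb_mem[OF F g[of n], of 1 "- 1"] y] y by (simp add: lincomb_def)
    then show "\<forall>\<^sub>F n in sequentially. cmod (F y - g n y) \<le>
        ip_norm ip (lincomb X 1 F (- 1) (g n)) * ip_norm ip (\<lambda>x\<in>X. K x y)" by simp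
    show "(\<lambda>n. ip_norm ip (lincomb X 1 F (- 1) (g n)) * ip_norm ip (\<lambda>x\<in>X. K x y)) \<longlonglongrightarrow> 0"
      using tendsto_mult_right[OF lim] by simp
  qed
  from tendsto_diff[OF tendsto_const[of "F y"] this] show ?thesis by simp
qed

lemma norm_limit:
  assumes F: "F \<in> H" and g: "\<And>n. g n \<in> H"
    and lim: "(\<lambda>n. ip_norm ip (lincomb X 1 F (- 1) (g n))) \<longlonglongrightarrow> 0"
  shows "(\<lambda>n. ip_norm ip (g n)) \<longlonglongrightarrow> ip_norm ip F"
proof -
  have "(\<lambda>n. ip_norm ip F - ip_norm ip (g n)) \<longlonglongrightarrow> 0"
    by (rule Lim_null_comparison[OF _ lim]) (use semi.reverse_triangle[OF F g] in simp)
  from tendsto_diff[OF tendsto_const[of "ip_norm ip F"] this] show ?thesis by simp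
qed

end

text \<open>
  An inner product with a kernel function is a value of the other factor, whatever the space. By
  linearity the kernel determines all inner products of linear combinations of kernel functions.
\<close>

lemma rkhs_norm_kernel_span_unique:
  assumes "rkhs X H ip K" "rkhs X H' ip' K" "G \<in> kernel_span X K"
  shows "ip_norm ip' G = ip_norm ip G"
proof -
  interpret A: rkhs X H ip K by fact
  interpret B: rkhs X H' ip' K by fact
  have "ip' F G = ip F G" if F: "F \<in> kernel_span X K" for F
    using assms(3)
  proof (induction rule: kernel_span.induct)
    case zero
    then show ?case
      using F by (simp only: A.ip_zero_right B.ip_zero_right A.kernel_span_subset B.kernel_span_subset)
  next
    case (kernel y)
    show ?case
      using A.reproducing[OF A.kernel_span_subset[OF F] kernel]
        B.reproducing[OF B.kernel_span_subset[OF F] kernel]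
      by (rule trans[OF sym, rotated])
  next
    case (lincomb G1 G2 a b)
    then show ?case
      using F by (simp add: A.semi.ip_lincomb_right B.semi.ip_lincomb_right
          A.kernel_span_subset B.kernel_span_subset)
  qed
  then show ?thesis
    using assms(3) by (simp add: ip_norm_def)
qed

text \<open>
  Kernel combinations approximating \<open>F\<close> in one space form a Cauchy sequence in the other, because
  their norms agree. The two limits agree at every point, so they are the same function.
\<close>

lemma rkhs_unique_subset:
  assumes "rkhs X H ip K" "rkhs X H' ip' K" "F \<in> H"
  shows "F \<in> H' \<and> ip_norm ip' F = ip_norm ip F"
proof -
  interpret A: rkhs X H ip K by fact
  interpret B: rkhs X H' ip' K by fact
  let ?D = "\<lambda>F G. lincomb X 1 F (- 1) G"
  obtain g where gS: "\<And>n. g n \<in> kernel_span X K" and lim: "(\<lambda>n. ip_norm ip (?D F (g n))) \<longlonglongrightarrow> 0"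
    using A.dense_kernel_span[OF assms(3)] by blast
  have gA: "g n \<in> H" and gB: "g n \<in> H'" for n
    using A.kernel_span_subset[OF gS] B.kernel_span_subset[OF gS] .
  have sub: "(\<lambda>x\<in>X. a x - b x) = ?D a b" for a b :: "'a \<Rightarrow> complex"
    by (auto simp: lincomb_def)
  have "\<exists>G\<in>H'. (\<lambda>n. ip_norm ip' (\<lambda>x\<in>X. g n x - G x)) \<longlonglongrightarrow> 0"
  proof (rule B.ip_complete[OF gB])
    fix e :: real assume "e > 0"
    then obtain N where N: "\<And>n. n \<ge> N \<Longrightarrow> ip_norm ip (?D F (g n)) < e/2"
      using order_tendstoD(2)[OF lim, of "e/2"] by (auto simp: eventually_sequentially)
    have "ip_norm ip' (\<lambda>x\<in>X. g m x - g n x) < e" if "m \<ge> N" "n \<ge> N" for m n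
    proof -
      have "ip_norm ip' (?D (g m) (g n)) = ip_norm ip (?D (g m) (g n))"
        by (rule rkhs_norm_kernel_span_unique[OF assms(1,2)]) (intro kernel_span.intros gS)
      also have "\<dots> \<le> ip_norm ip (?D (g m) F) + ip_norm ip (?D F (g n))"
        by (rule A.semi.triangle_diff[OF gA assms(3) gA])
      also have "ip_norm ip (?D (g m) F) = ip_norm ip (?D F (g m))"
        by (rule A.semi.norm_diff_commute[OF gA assms(3)])
      also have "ip_norm ip (?D F (g m)) + ip_norm ip (?D F (g n)) < e"
        using N[OF that(1)] N[OF that(2)] by linarith
      finally show ?thesis unfolding sub .
    qed
    then show "\<exists>N. \<forall>m\<ge>N. \<forall>n\<ge>N. ip_norm ip' (\<lambda>x\<in>X. g m x - g n x) < e" by blast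
  qed
  then obtain G where G: "G \<in> H'" and lim': "(\<lambda>n. ip_norm ip' (?D (g n) G)) \<longlonglongrightarrow> 0"
    unfolding sub by blast
  have lim'': "(\<lambda>n. ip_norm ip' (?D G (g n))) \<longlonglongrightarrow> 0"
    using lim' by (simp add: B.semi.norm_diff_commute[OF G gB])
  have "F x = G x" if "x \<in> X" for x
    using A.pointwise_limit[OF assms(3) gA that lim] B.pointwise_limit[OF G gB that lim'']
    by (rule LIMSEQ_unique)
  moreover have "F \<in> extensional X" "G \<in> extensional X"
    using A.functions_on B.functions_on assms(3) G by auto
  ultimately have FG: "F = G" by (metis extensionalityI)
  have "(\<lambda>n. ip_norm ip (g n)) \<longlonglongrightarrow> ip_norm ip' F"
    using B.norm_limit[OF G gB lim''] FG rkhs_norm_kernel_span_unique[OF assms(1,2) gS] by simp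
  then show ?thesis
    using A.norm_limit[OF assms(3) gA lim] LIMSEQ_unique G FG by blast
qed

theorem rkhs_unique:
  assumes "rkhs X H ip K" "rkhs X H' ip' K"
  shows "H = H'" and "F \<in> H \<Longrightarrow> ip_norm ip F = ip_norm ip' F"
proof -
  show "H = H'"
    using rkhs_unique_subset[OF assms] rkhs_unique_subset[OF assms(2,1)] by blast
  show "ip_norm ip F = ip_norm ip' F" if "F \<in> H"
    using rkhs_unique_subset[OF assms that] by simp
qed

section \<open>Completeness of the space of square integrable functions\<close>

definition L2_ip :: "'a measure \<Rightarrow> ('a \<Rightarrow> complex) \<Rightarrow> ('a \<Rightarrow> complex) \<Rightarrow> complex"
  where "L2_ip M f g = (\<integral>u. f u * cnj (g u) \<partial>M)"

lemma lincomb_UNIV: "lincomb UNIV a f b g = (\<lambda>u. a * f u + b * g u)"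
  by (simp add: lincomb_def restrict_def)

lemma L2_spaceI:
  "f \<in> borel_measurable M \<Longrightarrow> integrable M (\<lambda>u. (cmod (f u))\<^sup>2) \<Longrightarrow> f \<in> L2_space M"
  by (simp add: L2_space_def)

lemma
  assumes "f \<in> L2_space M"
  shows L2_space_measurable: "f \<in> borel_measurable M"
    and L2_space_integrable: "integrable M (\<lambda>u. (cmod (f u))\<^sup>2)"
  using assms by (auto simp: L2_space_def)

lemma integrable_L2_product:
  assumes "f \<in> L2_space M" "g \<in> L2_space M"
  shows "integrable M (\<lambda>u. f u * cnj (g u))"
proof (rule Bochner_Integration.integrable_bound)
  show "integrable M (\<lambda>u. (cmod (f u))\<^sup>2 + (cmod (g u))\<^sup>2)"
    by (intro Bochner_Integration.integrable_add L2_space_integrable assms)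
  have [measurable]: "f \<in> borel_measurable M" "g \<in> borel_measurable M"
    using assms by (auto intro: L2_space_measurable)
  have [measurable]: "(\<lambda>u. cnj (g u)) \<in> borel_measurable M"
    by (rule measurable_compose[OF _ borel_measurable_continuous_onI]) (auto intro!: continuous_intros)
  show "(\<lambda>u. f u * cnj (g u)) \<in> borel_measurable M" by measurable
  have "cmod (f u) * cmod (g u) \<le> (cmod (f u))\<^sup>2 + (cmod (g u))\<^sup>2" for u
  proof -
    have "0 \<le> cmod (f u) * cmod (g u)" by simp
    then show ?thesis using sum_squares_bound[of "cmod (f u)" "cmod (g u)"] by linarith
  qed
  then show "AE u in M. norm (f u * cnj (g u)) \<le> norm ((cmod (f u))\<^sup>2 + (cmod (g u))\<^sup>2)"
    by (simp add: norm_mult)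
qed

lemma L2_space_lincomb:
  assumes "f \<in> L2_space M" "g \<in> L2_space M"
  shows "lincomb UNIV a f b g \<in> L2_space M"
proof (rule L2_spaceI)
  have [measurable]: "f \<in> borel_measurable M" "g \<in> borel_measurable M"
    using assms by (auto intro: L2_space_measurable)
  show meas[measurable]: "lincomb UNIV a f b g \<in> borel_measurable M"
    unfolding lincomb_UNIV by measurable
  have bound: "(cmod (a * f u + b * g u))\<^sup>2 \<le> 2 * (cmod a)\<^sup>2 * (cmod (f u))\<^sup>2 + 2 * (cmod b)\<^sup>2 * (cmod (g u))\<^sup>2" for u
  proof -
    have "(cmod (a * f u + b * g u))\<^sup>2 \<le> (cmod (a * f u) + cmod (b * g u))\<^sup>2"
      by (rule power_mono[OF norm_triangle_ineq]) simp
    also have "\<dots> \<le> 2 * (cmod (a * f u))\<^sup>2 + 2 * (cmod (b * g u))\<^sup>2"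
      using sum_squares_bound[of "cmod (a * f u)" "cmod (b * g u)"] by (simp add: power2_sum)
    finally show ?thesis by (simp add: norm_mult power_mult_distrib)
  qed
  show "integrable M (\<lambda>u. (cmod (lincomb UNIV a f b g u))\<^sup>2)"
  proof (rule Bochner_Integration.integrable_bound)
    show "integrable M (\<lambda>u. 2 * (cmod a)\<^sup>2 * (cmod (f u))\<^sup>2 + 2 * (cmod b)\<^sup>2 * (cmod (g u))\<^sup>2)"
      by (intro Bochner_Integration.integrable_add integrable_mult_right L2_space_integrable assms)
  qed (use bound in \<open>auto simp: lincomb_UNIV\<close>)
qed

lemma ip_norm_L2_ip: "ip_norm (L2_ip M) f = L2_norm M f"
proof -
  have "(\<integral>u. f u * cnj (f u) \<partial>M) = complex_of_real (\<integral>u. (cmod (f u))\<^sup>2 \<partial>M)"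
    by (simp only: complex_norm_square[symmetric] integral_complex_of_real)
  then show ?thesis by (simp add: ip_norm_def L2_norm_def L2_ip_def)
qed

interpretation L2: semi_inner_functions UNIV "L2_space M" "L2_ip M" for M
proof
  show "L2_ip M (lincomb UNIV a F b G) L = a * L2_ip M F L + b * L2_ip M G L"
    if "F \<in> L2_space M" "G \<in> L2_space M" "L \<in> L2_space M" for a b F G L
  proof -
    have "L2_ip M (lincomb UNIV a F b G) L = (\<integral>u. a * (F u * cnj (L u)) + b * (G u * cnj (L u)) \<partial>M)"
      by (simp add: L2_ip_def lincomb_UNIV algebra_simps)
    also have "\<dots> = a * L2_ip M F L + b * L2_ip M G L"
      using integrable_L2_product[OF that(1,3)] integrable_L2_product[OF that(2,3)]
      by (simp add: L2_ip_def)
    finally show ?thesis .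
  qed
  show "L2_ip M G F = cnj (L2_ip M F G)" for F G
    unfolding L2_ip_def Bochner_Integration.integral_cnj[symmetric] by (simp add: mult.commute)
  show "0 \<le> Re (L2_ip M F F)" for F
    by (simp only: L2_ip_def complex_norm_square[symmetric] integral_complex_of_real) simp
qed (rule L2_space_lincomb)

text \<open>
  Riesz--Fischer. Take a subsequence \<open>g\<close> with \<open>\<parallel>g (k + 1) - g k\<parallel> \<le> 4\<^sup>-\<^sup>k\<close>. Then
  \<open>\<Sum>k. 4\<^sup>k |g (k + 1) - g k|\<^sup>2\<close> has finite integral, so it is finite almost everywhere. At such a point
  the differences are \<open>O(2\<^sup>-\<^sup>k)\<close> and the subsequence converges. Fatou's lemma turns the Cauchy estimates
  into estimates of the distance to the pointwise limit.
\<close>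

lemma L2_complete:
  assumes fs: "\<And>n. fs n \<in> L2_space M"
    and cauchy: "\<And>\<epsilon>. \<epsilon> > 0 \<Longrightarrow> \<exists>N::nat. \<forall>m\<ge>N. \<forall>n\<ge>N. L2_norm M (\<lambda>u. fs m u - fs n u) < \<epsilon>"
  shows "\<exists>f\<in>L2_space M. (\<lambda>n. L2_norm M (\<lambda>u. fs n u - f u)) \<longlonglongrightarrow> 0"
proof -
  have fm[measurable]: "fs n \<in> borel_measurable M" for n
    by (rule L2_space_measurable[OF fs])
  have int: "integrable M (\<lambda>u. (cmod (fs m u - fs n u))\<^sup>2)" for m n
    using L2_space_integrable[OF L2_space_lincomb[OF fs[of m] fs[of n], of 1 "- 1"]]
    by (simp add: lincomb_UNIV)
  obtain N where N: "\<And>k m n. m \<ge> N k \<Longrightarrow> n \<ge> N k \<Longrightarrow> L2_norm M (\<lambda>u. fs m u - fs n u) < (1/4) ^ k"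
    using cauchy[of "(1/4) ^ _"] by (metis zero_less_power zero_less_divide_1_iff zero_less_numeral)
  have small: "(\<integral>\<^sup>+u. ennreal ((cmod (fs m u - fs n u))\<^sup>2) \<partial>M) \<le> ennreal ((1/16) ^ k)"
    if "m \<ge> N k" "n \<ge> N k" for m n k
  proof -
    have "(L2_norm M (\<lambda>u. fs m u - fs n u))\<^sup>2 \<le> ((1/4) ^ k)\<^sup>2"
      by (rule power_mono) (use N[OF that] in \<open>auto simp: L2_norm_def\<close>)
    moreover have "((1/4) ^ k)\<^sup>2 = ((1/16) ^ k :: real)"
      by (simp add: power2_eq_square flip: power_mult_distrib)
    ultimately have "(\<integral>u. (cmod (fs m u - fs n u))\<^sup>2 \<partial>M) \<le> (1/16) ^ k"
      by (simp add: L2_norm_def)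
    then show ?thesis
      by (subst nn_integral_eq_integral[OF int]) (auto intro: ennreal_leI)
  qed
  \<comment> \<open>A monotone majorant of \<open>N\<close>; the indices need not increase strictly.\<close>
  define s where "s k = sum N {..k}" for k
  have s: "N k \<le> s j" if "k \<le> j" for k j
    unfolding s_def using that by (intro member_le_sum) auto
  define g where "g k = fs (s k)" for k
  have gm[measurable]: "g k \<in> borel_measurable M" for k
    by (simp add: g_def)
  have "(\<integral>\<^sup>+u. (\<Sum>k. ennreal (4 ^ k * (cmod (g (Suc k) u - g k u))\<^sup>2)) \<partial>M)
      = (\<Sum>k. \<integral>\<^sup>+u. ennreal (4 ^ k * (cmod (g (Suc k) u - g k u))\<^sup>2) \<partial>M)"
    by (rule nn_integral_suminf) measurable
  also have "\<dots> \<le> (\<Sum>k. ennreal ((1/4) ^ k))"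
  proof (rule suminf_le)
    fix k
    have "(\<integral>\<^sup>+u. ennreal (4 ^ k * (cmod (g (Suc k) u - g k u))\<^sup>2) \<partial>M)
        = ennreal (4 ^ k) * (\<integral>\<^sup>+u. ennreal ((cmod (g (Suc k) u - g k u))\<^sup>2) \<partial>M)"
      by (subst nn_integral_cmult[symmetric]) (auto simp: ennreal_mult)
    also have "\<dots> \<le> ennreal (4 ^ k) * ennreal ((1/16) ^ k)"
      unfolding g_def by (intro mult_left_mono small s) auto
    also have "\<dots> = ennreal ((1/4) ^ k)"
    proof -
      have "4 ^ k * (1/16) ^ k = ((1/4) ^ k :: real)"
        by (simp flip: power_mult_distrib)
      then show ?thesis by (simp flip: ennreal_mult)
    qed
    finally show "(\<integral>\<^sup>+u. ennreal (4 ^ k * (cmod (g (Suc k) u - g k u))\<^sup>2) \<partial>M) \<le> ennreal ((1/4) ^ k)" .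
  qed auto
  also have "\<dots> = ennreal (\<Sum>k. (1/4) ^ k)"
    by (rule suminf_ennreal2) (auto intro: summable_geometric)
  finally have "(\<integral>\<^sup>+u. (\<Sum>k. ennreal (4 ^ k * (cmod (g (Suc k) u - g k u))\<^sup>2)) \<partial>M) \<noteq> \<infinity>"
    by (auto simp: top_unique)
  then have "AE u in M. (\<Sum>k. ennreal (4 ^ k * (cmod (g (Suc k) u - g k u))\<^sup>2)) \<noteq> \<infinity>"
    by (intro nn_integral_PInf_AE) auto
  then have conv: "AE u in M. convergent (\<lambda>k. g k u)"
  proof eventually_elim
    fix u
    let ?S = "\<Sum>k. ennreal (4 ^ k * (cmod (g (Suc k) u - g k u))\<^sup>2)"
    assume "?S \<noteq> \<infinity>"
    then have "?S < top" by (simp only: infinity_ennreal_def less_top)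
    define C where "C = enn2real ?S"
    have C: "C \<ge> 0" "?S = ennreal C"
      unfolding C_def using ennreal_enn2real[OF \<open>?S < top\<close>] by (simp_all only: enn2real_nonneg)
    have bound: "cmod (g (Suc k) u - g k u) \<le> sqrt C * (1/2) ^ k" for k
    proof -
      have "ennreal (4 ^ k * (cmod (g (Suc k) u - g k u))\<^sup>2) \<le> ennreal C"
        using sum_le_suminf[of "\<lambda>k. ennreal (4 ^ k * (cmod (g (Suc k) u - g k u))\<^sup>2)" "{k}"] C(2) by simp
      then have "4 ^ k * (cmod (g (Suc k) u - g k u))\<^sup>2 \<le> C"
        using C(1) by simp
      moreover have "4 ^ k = ((2 ^ k)\<^sup>2 :: real)"
        by (simp add: power2_eq_square flip: power_mult_distrib)
      ultimately have "(2 ^ k * cmod (g (Suc k) u - g k u))\<^sup>2 \<le> C"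
        by (simp add: power_mult_distrib)
      then have "2 ^ k * cmod (g (Suc k) u - g k u) \<le> sqrt C"
        by (rule real_le_rsqrt)
      then show ?thesis
        by (simp add: field_simps power_divide)
    qed
    have "summable (\<lambda>k. g (Suc k) u - g k u)"
    proof (rule summable_comparison_test)
      show "\<exists>N. \<forall>k\<ge>N. norm (g (Suc k) u - g k u) \<le> sqrt C * (1/2) ^ k"
        using bound by blast
      show "summable (\<lambda>k. sqrt C * (1/2) ^ k)"
        by (intro summable_mult summable_geometric) simp
    qed
    then have "convergent (\<lambda>m. g m u - g 0 u)"
      by (simp add: summable_iff_convergent sum_lessThan_telescope[of "\<lambda>k. g k u"])
    then have "convergent (\<lambda>m. (g m u - g 0 u) + g 0 u)"
      by (intro convergent_add convergent_const)
    then show "convergent (\<lambda>k. g k u)" by simp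
  qed
  \<comment> \<open>Where the subsequence diverges, the value of \<open>lim\<close> is arbitrary but still measurable in \<open>u\<close>.\<close>
  define f where "f u = lim (\<lambda>k. g k u)" for u
  have [measurable]: "f \<in> borel_measurable M"
    unfolding f_def by (rule borel_measurable_lim_metric) measurable
  have lim: "AE u in M. (\<lambda>k. g k u) \<longlonglongrightarrow> f u"
    using conv by eventually_elim (simp add: f_def convergent_LIMSEQ_iff)
  have fatou: "(\<integral>\<^sup>+u. ennreal ((cmod (fs m u - f u))\<^sup>2) \<partial>M) \<le> ennreal ((1/16) ^ k)"
    if m: "m \<ge> N k" for m k
  proof -
    have "AE u in M. ennreal ((cmod (fs m u - f u))\<^sup>2) = liminf (\<lambda>j. ennreal ((cmod (fs m u - g j u))\<^sup>2))"
      using lim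
    proof eventually_elim
      fix u assume "(\<lambda>k. g k u) \<longlonglongrightarrow> f u"
      then have "(\<lambda>j. ennreal ((cmod (fs m u - g j u))\<^sup>2)) \<longlonglongrightarrow> ennreal ((cmod (fs m u - f u))\<^sup>2)"
        by (intro tendsto_ennrealI tendsto_intros)
      then show "ennreal ((cmod (fs m u - f u))\<^sup>2) = liminf (\<lambda>j. ennreal ((cmod (fs m u - g j u))\<^sup>2))"
        by (intro lim_imp_Liminf[symmetric]) auto
    qed
    then have "(\<integral>\<^sup>+u. ennreal ((cmod (fs m u - f u))\<^sup>2) \<partial>M)
        = (\<integral>\<^sup>+u. liminf (\<lambda>j. ennreal ((cmod (fs m u - g j u))\<^sup>2)) \<partial>M)"
      by (rule nn_integral_cong_AE)
    also have "\<dots> \<le> liminf (\<lambda>j. \<integral>\<^sup>+u. ennreal ((cmod (fs m u - g j u))\<^sup>2) \<partial>M)"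
      by (rule nn_integral_liminf) measurable
    also have "\<dots> \<le> limsup (\<lambda>j. \<integral>\<^sup>+u. ennreal ((cmod (fs m u - g j u))\<^sup>2) \<partial>M)"
      by (rule Liminf_le_Limsup) simp
    also have "\<dots> \<le> ennreal ((1/16) ^ k)"
      by (rule Limsup_bounded) (auto simp: g_def eventually_sequentially intro!: exI[of _ k] small m s)
    finally show ?thesis .
  qed
  have int_f: "integrable M (\<lambda>u. (cmod (fs m u - f u))\<^sup>2)" if "m \<ge> N k" for m k
    by (rule integrableI_bounded) (use fatou[OF that] in \<open>auto intro: le_less_trans\<close>)
  have f_L2: "f \<in> L2_space M"
  proof -
    have "(\<lambda>u. fs (N 0) u - f u) \<in> L2_space M"
      by (rule L2_spaceI) (auto intro: int_f[of 0])
    from L2_space_lincomb[OF fs[of "N 0"] this, of 1 "- 1"] show ?thesis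
      by (simp add: lincomb_UNIV)
  qed
  have norm_f: "L2_norm M (\<lambda>u. fs m u - f u) \<le> (1/4) ^ k" if "m \<ge> N k" for m k
  proof -
    have "ennreal (\<integral>u. (cmod (fs m u - f u))\<^sup>2 \<partial>M) \<le> ennreal ((1/16) ^ k)"
      using fatou[OF that] by (subst (asm) nn_integral_eq_integral[OF int_f[OF that]]) auto
    then have "(\<integral>u. (cmod (fs m u - f u))\<^sup>2 \<partial>M) \<le> (1/16) ^ k"
      by simp
    moreover have "((1/4) ^ k)\<^sup>2 = ((1/16) ^ k :: real)"
      by (simp add: power2_eq_square flip: power_mult_distrib)
    ultimately show ?thesis
      unfolding L2_norm_def by (intro real_le_lsqrt) auto
  qed
  have "(\<lambda>n. L2_norm M (\<lambda>u. fs n u - f u)) \<longlonglongrightarrow> 0"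
  proof (rule LIMSEQ_I)
    fix e :: real assume "e > 0"
    then obtain k where k: "(1/4) ^ k < e"
      using real_arch_pow_inv[of e "1/4"] by auto
    show "\<exists>no. \<forall>n\<ge>no. norm (L2_norm M (\<lambda>u. fs n u - f u) - 0) < e"
    proof (intro exI[of _ "N k"] allI impI)
      fix n assume "n \<ge> N k"
      then have "L2_norm M (\<lambda>u. fs n u - f u) < e"
        using norm_f[of k n] k by linarith
      then show "norm (L2_norm M (\<lambda>u. fs n u - f u) - 0) < e"
        by (simp add: L2_norm_def)
    qed
  qed
  with f_L2 show ?thesis by blast
qed

section \<open>Closed linear spans\<close>

lemma fun_span_base: "g \<in> S \<Longrightarrow> g \<in> fun_span S"
  unfolding fun_span_def by (auto intro!: exI[of _ "{g}"] exI[of _ "\<lambda>_. 1"])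

lemma fun_span_zero: "(\<lambda>_. 0) \<in> fun_span S"
  unfolding fun_span_def by (auto intro!: exI[of _ "{}"])

lemma fun_span_lincomb:
  assumes "f \<in> fun_span S" "g \<in> fun_span S"
  shows "lincomb UNIV a f b g \<in> fun_span S"
proof -
  obtain A c where A: "finite A" "A \<subseteq> S" "f = (\<lambda>u. \<Sum>h\<in>A. c h * h u)"
    using assms(1) unfolding fun_span_def by blast
  obtain B d where B: "finite B" "B \<subseteq> S" "g = (\<lambda>u. \<Sum>h\<in>B. d h * h u)"
    using assms(2) unfolding fun_span_def by blast
  let ?e = "\<lambda>h. a * (if h \<in> A then c h else 0) + b * (if h \<in> B then d h else 0)"
  have "lincomb UNIV a f b g = (\<lambda>u. \<Sum>h\<in>A \<union> B. ?e h * h u)"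
  proof
    fix u
    have "(\<Sum>h\<in>A \<union> B. (if h \<in> A then c h else 0) * h u) = (\<Sum>h\<in>A. c h * h u)"
      using A(1) B(1) by (intro sum.mono_neutral_cong_right) auto
    moreover have "(\<Sum>h\<in>A \<union> B. (if h \<in> B then d h else 0) * h u) = (\<Sum>h\<in>B. d h * h u)"
      using A(1) B(1) by (intro sum.mono_neutral_cong_right) auto
    moreover have "(\<Sum>h\<in>A \<union> B. ?e h * h u) =
        a * (\<Sum>h\<in>A \<union> B. (if h \<in> A then c h else 0) * h u) +
        b * (\<Sum>h\<in>A \<union> B. (if h \<in> B then d h else 0) * h u)"
      unfolding sum_distrib_left sum.distrib[symmetric] by (intro sum.cong) (auto simp: algebra_simps)
    ultimately show "lincomb UNIV a f b g u = (\<Sum>h\<in>A \<union> B. ?e h * h u)"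
      by (simp add: lincomb_UNIV A(3) B(3))
  qed
  moreover have "finite (A \<union> B)" "A \<union> B \<subseteq> S"
    using A B by auto
  ultimately show ?thesis
    unfolding fun_span_def by (intro CollectI exI[of _ "A \<union> B"] exI[of _ ?e] conjI)
qed

lemma fun_span_least:
  assumes "S \<subseteq> V" "(\<lambda>_. 0) \<in> V" "\<And>f g a b. f \<in> V \<Longrightarrow> g \<in> V \<Longrightarrow> lincomb UNIV a f b g \<in> V"
  shows "fun_span S \<subseteq> V"
proof
  fix f assume "f \<in> fun_span S"
  then obtain A c where A: "finite A" "A \<subseteq> S" and f: "f = (\<lambda>u. \<Sum>h\<in>A. c h * h u)"
    unfolding fun_span_def by blast
  from A have "(\<lambda>u. \<Sum>h\<in>A. c h * h u) \<in> V"
  proof (induction A)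
    case empty
    then show ?case using assms(2) by simp
  next
    case (insert x A)
    then have "lincomb UNIV (c x) x 1 (\<lambda>u. \<Sum>h\<in>A. c h * h u) \<in> V"
      using assms(1) by (intro assms(3)) auto
    then show ?case using insert by (simp add: lincomb_UNIV)
  qed
  then show "f \<in> V" by (simp add: f)
qed

lemma zero_in_L2_space: "(\<lambda>_. 0) \<in> L2_space M"
  by (rule L2_spaceI) auto

lemma fun_span_subset_L2: "S \<subseteq> L2_space M \<Longrightarrow> fun_span S \<subseteq> L2_space M"
  by (rule fun_span_least) (auto intro: L2_space_lincomb zero_in_L2_space)

lemma L2_closed_span_base:
  assumes "f \<in> fun_span S" "S \<subseteq> L2_space M"
  shows "f \<in> L2_closed_span M S"
proof -
  have "L2_norm M (\<lambda>u. f u - f u) = 0" by (simp add: L2_norm_def)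
  then show ?thesis
    using assms fun_span_subset_L2[OF assms(2)] unfolding L2_closed_span_def
    by (auto intro!: bexI[of _ f])
qed

lemma L2_closed_span_subset: "L2_closed_span M S \<subseteq> L2_space M"
  by (auto simp: L2_closed_span_def)

lemma L2_closed_span_closed:
  assumes S: "S \<subseteq> L2_space M" and f: "f \<in> L2_space M"
    and approx: "\<And>\<epsilon>. \<epsilon> > 0 \<Longrightarrow> \<exists>h\<in>L2_closed_span M S. L2_norm M (\<lambda>u. f u - h u) < \<epsilon>"
  shows "f \<in> L2_closed_span M S"
proof -
  have "\<exists>g\<in>fun_span S. L2_norm M (\<lambda>u. f u - g u) < \<epsilon>" if pos: "\<epsilon> > 0" for \<epsilon>
  proof -
    obtain h where h: "h \<in> L2_closed_span M S" "L2_norm M (\<lambda>u. f u - h u) < \<epsilon>/2"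
      using approx[OF half_gt_zero[OF pos]] by blast
    obtain g where g: "g \<in> fun_span S" "L2_norm M (\<lambda>u. h u - g u) < \<epsilon>/2"
      using h(1) half_gt_zero[OF pos] unfolding L2_closed_span_def by blast
    have "h \<in> L2_space M" "g \<in> L2_space M"
      using h(1) g(1) L2_closed_span_subset fun_span_subset_L2[OF S] by blast+
    from L2.triangle_diff[OF f this] h(2) g(2) have "L2_norm M (\<lambda>u. f u - g u) < \<epsilon>"
      by (simp add: ip_norm_L2_ip lincomb_UNIV)
    with g(1) show ?thesis by blast
  qed
  with f show ?thesis by (simp add: L2_closed_span_def)
qed

lemma L2_closed_span_lincomb:
  assumes S: "S \<subseteq> L2_space M" and "f \<in> L2_closed_span M S" "g \<in> L2_closed_span M S"
  shows "lincomb UNIV a f b g \<in> L2_closed_span M S"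
proof -
  have L2: "f \<in> L2_space M" "g \<in> L2_space M"
    using assms L2_closed_span_subset by blast+
  have "\<exists>h\<in>fun_span S. L2_norm M (\<lambda>u. lincomb UNIV a f b g u - h u) < \<epsilon>" if "\<epsilon> > 0" for \<epsilon>
  proof -
    define \<delta> where "\<delta> = \<epsilon> / (1 + cmod a + cmod b)"
    have pos: "0 < 1 + cmod a + cmod b" by (simp add: add_pos_nonneg)
    have \<delta>: "\<delta> > 0" using pos that by (simp add: \<delta>_def)
    obtain f' where f': "f' \<in> fun_span S" "L2_norm M (\<lambda>u. f u - f' u) < \<delta>"
      using assms(2) \<delta> unfolding L2_closed_span_def by auto
    obtain g' where g': "g' \<in> fun_span S" "L2_norm M (\<lambda>u. g u - g' u) < \<delta>"
      using assms(3) \<delta> unfolding L2_closed_span_def by auto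
    let ?h = "lincomb UNIV a f' b g'"
    let ?df = "lincomb UNIV 1 f (- 1) f'" and ?dg = "lincomb UNIV 1 g (- 1) g'"
    have L2': "f' \<in> L2_space M" "g' \<in> L2_space M"
      using f'(1) g'(1) fun_span_subset_L2[OF S] by blast+
    have "L2_norm M (\<lambda>u. lincomb UNIV a f b g u - ?h u) = L2_norm M (lincomb UNIV a ?df b ?dg)"
      by (simp add: lincomb_UNIV algebra_simps)
    also have "\<dots> \<le> cmod a * L2_norm M ?df + cmod b * L2_norm M ?dg"
      using L2.triangle[OF L2_space_lincomb L2_space_lincomb, OF L2(1) L2'(1) L2(2) L2'(2)]
      by (simp add: ip_norm_L2_ip)
    also have "\<dots> \<le> cmod a * \<delta> + cmod b * \<delta>"
      using f'(2) g'(2) by (intro add_mono mult_left_mono) (auto simp: lincomb_UNIV)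
    also have "\<dots> < (1 + cmod a + cmod b) * \<delta>"
      using \<delta> by (simp add: algebra_simps)
    also have "\<dots> = \<epsilon>"
      using pos by (simp add: \<delta>_def)
    finally show ?thesis
      using fun_span_lincomb[OF f'(1) g'(1)] by blast
  qed
  then show ?thesis
    using L2_space_lincomb[OF L2] by (simp add: L2_closed_span_def)
qed

lemma L2_closed_span_eqI:
  assumes "S \<subseteq> fun_span S'" "S' \<subseteq> fun_span S"
  shows "L2_closed_span M S = L2_closed_span M S'"
proof -
  have "fun_span S = fun_span S'"
    using assms by (intro equalityI fun_span_least) (auto intro: fun_span_lincomb fun_span_zero)
  then show ?thesis by (simp add: L2_closed_span_def)
qed

text \<open>
  Otherwise some \<open>g\<close> in the span satisfies \<open>\<parallel>f - g\<parallel> < \<parallel>f\<parallel>\<close>, and orthogonality to \<open>g\<close> gives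
  \<open>\<parallel>f\<parallel>\<^sup>2 = \<langle>f, f - g\<rangle> \<le> \<parallel>f\<parallel> \<parallel>f - g\<parallel> < \<parallel>f\<parallel>\<^sup>2\<close>.
\<close>

lemma L2_closed_span_orthogonal:
  assumes S: "S \<subseteq> L2_space M" and f: "f \<in> L2_closed_span M S"
    and ort: "\<And>g. g \<in> S \<Longrightarrow> L2_ip M f g = 0"
  shows "L2_norm M f = 0"
proof (rule ccontr)
  assume "L2_norm M f \<noteq> 0"
  moreover have fL: "f \<in> L2_space M" using f L2_closed_span_subset by blast
  ultimately have pos: "L2_norm M f > 0"
    using L2.norm_nonneg[OF fL] by (simp add: ip_norm_L2_ip)
  then obtain g where g: "g \<in> fun_span S" and less: "L2_norm M (\<lambda>u. f u - g u) < L2_norm M f"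
    using f by (auto simp: L2_closed_span_def)
  have "fun_span S \<subseteq> {g \<in> L2_space M. L2_ip M f g = 0}"
    by (rule fun_span_least)
       (use S ort in \<open>auto simp: L2.ip_lincomb_right[OF _ _ fL] L2_space_lincomb zero_in_L2_space, simp add: L2_ip_def\<close>)
  with g have gL: "g \<in> L2_space M" and fg: "L2_ip M f g = 0" by auto
  have "L2_ip M f f = L2_ip M f (lincomb UNIV 1 f (- 1) g)"
    using fg by (simp add: L2.ip_lincomb_right[OF fL gL fL])
  then have "(L2_norm M f)\<^sup>2 \<le> cmod (L2_ip M f (lincomb UNIV 1 f (- 1) g))"
    using L2.norm_squared[OF fL] complex_Re_le_cmod by (metis ip_norm_L2_ip)
  also have "\<dots> \<le> L2_norm M f * L2_norm M (\<lambda>u. f u - g u)"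
    using L2.cauchy_schwarz[OF fL L2_space_lincomb[OF fL gL, of 1 "- 1"]]
    by (simp add: ip_norm_L2_ip) (simp add: lincomb_UNIV)
  finally show False
    using pos less by (simp add: power2_eq_square)
qed

section \<open>The reproducing kernel Hilbert space of a feature map\<close>

text \<open>
  The inner product on the range of \<open>V\<close> is carried over from the square integrable functions. This is
  well defined since two functions in \<open>N\<close> with the same image differ by a function orthogonal to all \<open>k x\<close>,
  hence of norm zero. The image of \<open>k y\<close> is the kernel function at \<open>y\<close>, which makes the reproducing property
  the definition of \<open>V\<close>.
\<close>

lemma feature_map_rkhs:
  fixes M :: "'b measure" and k :: "'a \<Rightarrow> 'b \<Rightarrow> complex"
  assumes k: "\<And>y. y \<in> X \<Longrightarrow> k y \<in> L2_space M"
  defines "N \<equiv> L2_closed_span M (k ` X)"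
    and "V \<equiv> \<lambda>f. (\<lambda>x\<in>X. L2_ip M f (k x))"
  shows "\<exists>ip. rkhs X (V ` N) ip (\<lambda>x y. L2_ip M (k y) (k x)) \<and>
    (\<forall>f\<in>N. ip_norm ip (V f) = L2_norm M f)"
proof -
  have S: "k ` X \<subseteq> L2_space M" using k by blast
  have NL: "f \<in> L2_space M" if "f \<in> N" for f
    using that L2_closed_span_subset unfolding N_def by blast
  have N_lincomb: "lincomb UNIV a f b g \<in> N" if "f \<in> N" "g \<in> N" for a b f g
    using that unfolding N_def by (rule L2_closed_span_lincomb[OF S])
  have kN: "k y \<in> N" if "y \<in> X" for y
    unfolding N_def using that S by (intro L2_closed_span_base fun_span_base) auto
  have zN: "(\<lambda>_. 0) \<in> N"
    unfolding N_def using S by (intro L2_closed_span_base fun_span_zero)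
  have V_lincomb: "V (lincomb UNIV a f b g) = (\<lambda>x\<in>X. a * V f x + b * V g x)" if "f \<in> N" "g \<in> N" for a b f g
    unfolding V_def by (rule restrict_ext) (simp add: L2.ip_lincomb_left NL that k)
  have V_zero: "V (\<lambda>_. 0) = (\<lambda>x\<in>X. 0)"
    by (simp add: V_def L2_ip_def)
  have inj: "L2_norm M (lincomb UNIV 1 f (- 1) g) = 0" if "f \<in> N" "g \<in> N" "V f = V g" for f g
  proof (rule L2_closed_span_orthogonal[OF S])
    show "lincomb UNIV 1 f (- 1) g \<in> L2_closed_span M (k ` X)"
      using N_lincomb[OF that(1,2)] by (simp add: N_def)
    fix h assume "h \<in> k ` X"
    then obtain x where x: "x \<in> X" "h = k x" by blast
    have "V f x = V g x" using that by simp
    with x show "L2_ip M (lincomb UNIV 1 f (- 1) g) h = 0"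
      by (simp add: L2.ip_lincomb_left NL that k V_def)
  qed
  have ip_left: "L2_ip M f h = L2_ip M g h" if "f \<in> N" "g \<in> N" "V f = V g" "h \<in> N" for f g h
  proof -
    have "cmod (L2_ip M (lincomb UNIV 1 f (- 1) g) h) \<le> 0"
      using L2.cauchy_schwarz[OF NL[OF N_lincomb[OF that(1,2), of 1 "- 1"]] NL[OF that(4)]] inj[OF that(1-3)]
      by (simp add: ip_norm_L2_ip)
    then show ?thesis
      by (simp add: L2.ip_lincomb_left NL that)
  qed
  have ip_right: "L2_ip M h f = L2_ip M h g" if "f \<in> N" "g \<in> N" "V f = V g" "h \<in> N" for f g h
    using ip_left[OF that] L2.ip_commute[OF NL[OF that(1)] NL[OF that(4)]]
      L2.ip_commute[OF NL[OF that(2)] NL[OF that(4)]] by simp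
  \<comment> \<open>A preimage under \<open>V\<close>, unique up to a function of norm zero.\<close>
  define R where "R F = (SOME f. f \<in> N \<and> V f = F)" for F
  define ip where "ip F G = L2_ip M (R F) (R G)" for F G
  have R: "R (V f) \<in> N" "V (R (V f)) = V f" if "f \<in> N" for f
    using someI[of "\<lambda>g. g \<in> N \<and> V g = V f" f] that unfolding R_def by auto
  have ip: "ip (V f) (V g) = L2_ip M f g" if "f \<in> N" "g \<in> N" for f g
    unfolding ip_def using ip_left[OF R(1) that(1) R(2) R(1)] ip_right[OF R(1) that(2) R(2) that(1)] that
    by simp
  have ip_norm_V: "ip_norm ip (V f) = L2_norm M f" if "f \<in> N" for f
    using ip[OF that that] by (simp add: ip_norm_L2_ip[symmetric] ip_norm_def)
  have V_add: "(\<lambda>x\<in>X. V f x + V g x) = V (lincomb UNIV 1 f 1 g)"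
    and V_diff: "(\<lambda>x\<in>X. V f x - V g x) = V (lincomb UNIV 1 f (- 1) g)"
    and V_scale: "(\<lambda>x\<in>X. c * V f x) = V (lincomb UNIV c f 0 f)" if "f \<in> N" "g \<in> N" for f g c
    using that by (simp_all add: V_lincomb)
  have "rkhs X (V ` N) ip (\<lambda>x y. L2_ip M (k y) (k x))"
  proof (intro rkhs.intro function_hilbert_space.intro rkhs_axioms.intro)
    show "V ` N \<subseteq> extensional X" by (auto simp: V_def)
    show "(\<lambda>x\<in>X. 0) \<in> V ` N" using zN V_zero by (metis imageI)
    show "(\<lambda>x\<in>X. F x + G x) \<in> V ` N" if "F \<in> V ` N" "G \<in> V ` N" for F G
      using that by (auto simp: V_add N_lincomb)
    show "(\<lambda>x\<in>X. c * F x) \<in> V ` N" if "F \<in> V ` N" for F c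
      using that by (auto simp: V_scale N_lincomb)
    show "ip (\<lambda>x\<in>X. F x + G x) L = ip F L + ip G L" if "F \<in> V ` N" "G \<in> V ` N" "L \<in> V ` N" for F G L
      using that by (auto simp: V_add N_lincomb ip L2.ip_lincomb_left NL)
    show "ip (\<lambda>x\<in>X. c * F x) G = c * ip F G" if "F \<in> V ` N" "G \<in> V ` N" for F G c
      using that by (auto simp: V_scale N_lincomb ip L2.ip_lincomb_left NL)
    show "ip G F = cnj (ip F G)" if FG: "F \<in> V ` N" "G \<in> V ` N" for F G
    proof -
      obtain f g where fg: "f \<in> N" "g \<in> N" "F = V f" "G = V g" using FG by blast
      show ?thesis unfolding fg(3,4) ip[OF fg(1,2)] ip[OF fg(2,1)]
        by (rule L2.ip_commute[OF NL[OF fg(1)] NL[OF fg(2)]])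
    qed
    show "0 \<le> Re (ip F F)" if "F \<in> V ` N" for F
      using that by (auto simp: ip NL L2.ip_nonneg)
    show "F = (\<lambda>x\<in>X. 0)" if F: "F \<in> V ` N" and zero: "ip F F = 0" for F
    proof -
      obtain f where f: "f \<in> N" "F = V f" using F by blast
      have nf: "ip_norm (L2_ip M) f = 0"
        using zero f by (simp add: ip ip_norm_def)
      have "L2_ip M f (k x) = 0" if "x \<in> X" for x
        using L2.cauchy_schwarz[OF NL[OF f(1)] k[OF that]] by (simp add: nf)
      then show ?thesis
        unfolding f(2) V_def by (intro restrict_ext) simp
    qed
    show "\<exists>F\<in>V ` N. (\<lambda>n. ip_norm ip (\<lambda>x\<in>X. Fs n x - F x)) \<longlonglongrightarrow> 0"
      if Fs: "\<And>n. Fs n \<in> V ` N"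
        and cau: "\<And>\<epsilon>. \<epsilon> > 0 \<Longrightarrow> \<exists>N::nat. \<forall>m\<ge>N. \<forall>n\<ge>N. ip_norm ip (\<lambda>x\<in>X. Fs m x - Fs n x) < \<epsilon>" for Fs
    proof -
      have "\<forall>n. \<exists>f\<in>N. Fs n = V f" using Fs by blast
      then obtain fs where fs: "\<And>n. fs n \<in> N" "\<And>n. Fs n = V (fs n)" by metis
      have norm_eq: "ip_norm ip (\<lambda>x\<in>X. V f x - V g x) = L2_norm M (\<lambda>u. f u - g u)"
        if "f \<in> N" "g \<in> N" for f g
        using that by (simp add: V_diff ip_norm_V N_lincomb) (simp add: lincomb_UNIV)
      have "\<exists>f\<in>L2_space M. (\<lambda>n. L2_norm M (\<lambda>u. fs n u - f u)) \<longlonglongrightarrow> 0"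
        by (rule L2_complete) (use cau fs in \<open>simp_all add: NL norm_eq\<close>)
      then obtain f where f: "f \<in> L2_space M" and lim: "(\<lambda>n. L2_norm M (\<lambda>u. fs n u - f u)) \<longlonglongrightarrow> 0"
        by blast
      have "f \<in> N" unfolding N_def
      proof (rule L2_closed_span_closed[OF S f])
        fix \<epsilon> :: real assume "\<epsilon> > 0"
        then obtain n where "L2_norm M (\<lambda>u. fs n u - f u) < \<epsilon>"
          using order_tendstoD(2)[OF lim] by (auto simp: eventually_sequentially)
        then have "L2_norm M (\<lambda>u. f u - fs n u) < \<epsilon>"
          by (simp add: L2_norm_def norm_minus_commute)
        then show "\<exists>h\<in>L2_closed_span M (k ` X). L2_norm M (\<lambda>u. f u - h u) < \<epsilon>"
          using fs(1)[of n] unfolding N_def by blast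
      qed
      then show ?thesis
        using lim by (intro bexI[of _ "V f"]) (auto simp: fs norm_eq)
    qed
    have V_k: "(\<lambda>x\<in>X. L2_ip M (k y) (k x)) = V (k y)" for y
      by (simp add: V_def)
    show "(\<lambda>x\<in>X. L2_ip M (k y) (k x)) \<in> V ` N" if "y \<in> X" for y
      unfolding V_k using kN[OF that] by blast
    show "F y = ip F (\<lambda>x\<in>X. L2_ip M (k y) (k x))" if "F \<in> V ` N" "y \<in> X" for F y
      unfolding V_k using that kN[OF that(2)] by (auto simp: ip) (simp add: V_def)
  qed
  with ip_norm_V show ?thesis by blast
qed

section \<open>The kernel\<close>

text \<open>
  \<open>|exp (i x) - 1| \<le> min |x| 2\<close> gives both \<open>|chi t u| \<le> |t|\<close> and \<open>|chi t u| |u| \<le> 2\<close>; add the two and use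
  \<open>sqrt (u\<^sup>2 + 1) \<le> 1 + |u|\<close>. The weight \<open>1 / sqrt (u\<^sup>2 + 1)\<close> is the one that the assumption on \<open>\<sigma>\<close> makes
  square integrable.
\<close>

lemma chi_bound: "cmod (chi t u) \<le> (\<bar>t\<bar> + 2) / sqrt (u\<^sup>2 + 1)"
proof -
  have "cmod (chi t u) * (1 + \<bar>u\<bar>) \<le> \<bar>t\<bar> + 2"
  proof (cases "u = 0")
    case True
    then show ?thesis by (simp add: chi_def)
  next
    case False
    have e: "exp (\<i> * of_real t * of_real u) = iexp (t * u)" by (simp add: mult_ac)
    have chi: "cmod (chi t u) * \<bar>u\<bar> = cmod (iexp (t * u) - 1)"
      using False unfolding chi_def e by (simp add: norm_divide norm_mult)
    have "cmod (chi t u) * \<bar>u\<bar> \<le> \<bar>t\<bar> * \<bar>u\<bar>"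
      unfolding chi using iexp_approx1[of "t * u" 0] by (simp add: abs_mult)
    then have "cmod (chi t u) \<le> \<bar>t\<bar>"
      using False by simp
    moreover have "cmod (chi t u) * \<bar>u\<bar> \<le> 2"
      unfolding chi using iexp_approx2[of "t * u" 0] by simp
    ultimately show ?thesis by (simp add: algebra_simps)
  qed
  moreover have "sqrt (u\<^sup>2 + 1) \<le> 1 + \<bar>u\<bar>"
    by (rule real_le_lsqrt) (auto simp: power2_sum)
  then have "cmod (chi t u) * sqrt (u\<^sup>2 + 1) \<le> cmod (chi t u) * (1 + \<bar>u\<bar>)"
    by (intro mult_left_mono) auto
  ultimately have "cmod (chi t u) * sqrt (u\<^sup>2 + 1) \<le> \<bar>t\<bar> + 2" by linarith
  then show ?thesis
    by (simp add: pos_le_divide_eq add_nonneg_pos)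
qed

lemma cnj_chi: "cnj (chi t u) = - chi (- t) u"
  by (simp add: chi_def exp_cnj)

lemma chi_measurable_pair: "(\<lambda>(t, u). chi t u) \<in> borel_measurable (borel \<Otimes>\<^sub>M borel)"
  unfolding chi_def by measurable

lemma chi_measurable: "chi t \<in> borel_measurable borel"
  using measurable_compose[OF measurable_Pair1'[of t borel borel] chi_measurable_pair] by simp

lemma r_integrand_measurable: "r_integrand t \<in> borel_measurable borel"
  unfolding r_integrand_def by measurable

text \<open>
  For \<open>|u| \<le> 1\<close> the correction term differs from \<open>i t u\<close> by \<open>i t u\<^sup>3 / (u\<^sup>2 + 1)\<close>, and the second order Taylor
  estimate of the exponential applies; for \<open>|u| > 1\<close> the numerator is at most \<open>2 + |t|\<close> and
  \<open>u\<^sup>2 + 1 \<le> 2 u\<^sup>2\<close>.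
\<close>

lemma r_integrand_bound: "cmod (r_integrand t u) \<le> (t\<^sup>2 + 2 * \<bar>t\<bar> + 4) * (1 / (u\<^sup>2 + 1))"
proof (cases "u = 0")
  case True
  then show ?thesis by (simp add: r_integrand_def norm_divide norm_power)
next
  case False
  have u2: "u\<^sup>2 > 0" using False by simp
  have pos: "u\<^sup>2 + 1 > 0" by (rule add_nonneg_pos) auto
  have e: "exp (\<i> * of_real t * of_real u) = iexp (t * u)" by (simp add: mult_ac)
  define R where "R = iexp (t * u) - 1 - \<i> * of_real t * of_real u / ((of_real u)\<^sup>2 + 1)"
  have r: "cmod (r_integrand t u) = cmod R / u\<^sup>2"
    using False unfolding r_integrand_def e R_def by (simp add: norm_divide norm_power)
  have c: "cmod ((of_real u)\<^sup>2 + 1) = u\<^sup>2 + 1"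
  proof -
    have "((of_real u)\<^sup>2 + 1 :: complex) = of_real (u\<^sup>2 + 1)" by simp
    then show ?thesis using pos by (simp only: norm_of_real)
  qed
  have nz: "(of_real u)\<^sup>2 + 1 \<noteq> (0 :: complex)"
    using c pos by (metis norm_zero less_irrefl)
  have "cmod R * (u\<^sup>2 + 1) \<le> (t\<^sup>2 + 2 * \<bar>t\<bar> + 4) * u\<^sup>2"
  proof (cases "\<bar>u\<bar> \<le> 1")
    case True
    have "R = (iexp (t * u) - 1 - \<i> * of_real (t * u)) + \<i> * of_real t * of_real u * (of_real u)\<^sup>2 / ((of_real u)\<^sup>2 + 1)"
      using nz unfolding R_def by (simp add: field_simps)
    then have "cmod R \<le> cmod (iexp (t * u) - 1 - \<i> * of_real (t * u))
        + cmod (\<i> * of_real t * of_real u * (of_real u)\<^sup>2 / ((of_real u)\<^sup>2 + 1))"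
      by (metis norm_triangle_ineq)
    also have "cmod (iexp (t * u) - 1 - \<i> * of_real (t * u)) \<le> t\<^sup>2 * u\<^sup>2 / 2"
      using iexp_approx1[of "t * u" 1] by (simp add: power_mult_distrib numeral_2_eq_2[symmetric] diff_diff_eq)
    also have "cmod (\<i> * of_real t * of_real u * (of_real u)\<^sup>2 / ((of_real u)\<^sup>2 + 1)) = \<bar>t\<bar> * \<bar>u\<bar> * u\<^sup>2 / (u\<^sup>2 + 1)"
      by (simp add: norm_divide norm_mult norm_power c)
    finally have "cmod R * (u\<^sup>2 + 1) \<le> (t\<^sup>2 * u\<^sup>2 / 2 + \<bar>t\<bar> * \<bar>u\<bar> * u\<^sup>2 / (u\<^sup>2 + 1)) * (u\<^sup>2 + 1)"
      using pos by (intro mult_right_mono) auto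
    also have "\<dots> = (t\<^sup>2 / 2 * (u\<^sup>2 + 1) + \<bar>t\<bar> * \<bar>u\<bar>) * u\<^sup>2"
      using pos by (simp add: field_simps)
    also have "\<dots> \<le> (t\<^sup>2 + 2 * \<bar>t\<bar> + 4) * u\<^sup>2"
    proof (rule mult_right_mono)
      have "u\<^sup>2 \<le> 1" using True by (simp add: abs_square_le_1)
      then have "t\<^sup>2 / 2 * (u\<^sup>2 + 1) \<le> t\<^sup>2 / 2 * 2" by (intro mult_left_mono) auto
      moreover have "\<bar>t\<bar> * \<bar>u\<bar> \<le> \<bar>t\<bar> * 1" using True by (intro mult_left_mono) auto
      ultimately show "t\<^sup>2 / 2 * (u\<^sup>2 + 1) + \<bar>t\<bar> * \<bar>u\<bar> \<le> t\<^sup>2 + 2 * \<bar>t\<bar> + 4" by simp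
    qed simp
    finally show ?thesis .
  next
    case False
    then have u1: "1 \<le> u\<^sup>2" using abs_le_square_iff[of 1 u] by simp
    have "\<bar>u\<bar> \<le> u\<^sup>2 + 1"
      using sum_squares_bound[of "\<bar>u\<bar>" 1] by simp
    then have frac: "\<bar>t\<bar> * \<bar>u\<bar> / (u\<^sup>2 + 1) \<le> \<bar>t\<bar>"
      using pos by (simp add: divide_le_eq mult_left_mono)
    have "cmod R \<le> cmod (iexp (t * u) - 1) + cmod (\<i> * of_real t * of_real u / ((of_real u)\<^sup>2 + 1))"
      unfolding R_def by (rule norm_triangle_ineq4)
    also have "\<dots> \<le> 2 + \<bar>t\<bar>"
      using iexp_approx2[of "t * u" 0] frac by (simp add: norm_divide norm_mult c)
    finally have "cmod R * (u\<^sup>2 + 1) \<le> (2 + \<bar>t\<bar>) * (2 * u\<^sup>2)"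
      using u1 by (intro mult_mono) auto
    also have "\<dots> \<le> (t\<^sup>2 + 2 * \<bar>t\<bar> + 4) * u\<^sup>2"
      by (simp add: algebra_simps)
    finally show ?thesis .
  qed
  then show ?thesis
    unfolding r using u2 pos by (simp add: field_simps)
qed

text \<open>
  With \<open>a = exp (i t u)\<close> and \<open>b = exp (- i s u)\<close> this is \<open>(a - 1) + (b - 1) - (a b - 1) = - (a - 1) (b - 1)\<close>,
  divided by \<open>u\<^sup>2\<close>; the linear corrections are additive in the time argument and cancel.
\<close>

lemma r_integrand_kernel:
  "r_integrand t u + cnj (r_integrand s u) - r_integrand (t - s) u = - (chi t u * cnj (chi s u))"
proof (cases "u = 0")
  case True
  then show ?thesis
    by (simp add: r_integrand_def chi_def power2_eq_square algebra_simps diff_divide_distrib add_divide_distrib)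
next
  case False
  define a where "a = exp (\<i> * of_real t * of_real u)"
  define b where "b = exp (- (\<i> * of_real s * of_real u))"
  define w where "w = \<i> * of_real u / ((of_real u)\<^sup>2 + 1 :: complex)"
  define v where "v = (of_real u :: complex)"
  have v: "v \<noteq> 0" using False by (simp add: v_def)
  have ab: "exp (\<i> * of_real (t - s) * of_real u) = a * b"
    by (simp add: a_def b_def exp_add[symmetric] algebra_simps)
  have cb: "cnj (exp (\<i> * of_real s * of_real u)) = b"
    by (simp add: b_def exp_cnj)
  have rt: "r_integrand t u = (a - 1 - of_real t * w) / v\<^sup>2"
    using False by (simp add: r_integrand_def a_def w_def v_def)
  have rs: "cnj (r_integrand s u) = (b - 1 + of_real s * w) / v\<^sup>2"
    using False by (simp add: r_integrand_def cb w_def v_def)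
  have rd: "r_integrand (t - s) u = (a * b - 1 - of_real (t - s) * w) / v\<^sup>2"
    using False by (simp only: r_integrand_def ab v_def if_False) (simp add: w_def)
  have ct: "chi t u = (a - 1) / (\<i> * v)"
    using False by (simp add: chi_def a_def v_def)
  have cs: "cnj (chi s u) = (b - 1) / (- \<i> * v)"
    using False by (simp add: chi_def cb v_def)
  show ?thesis
    unfolding rt rs rd ct cs using v by (simp add: field_simps power2_eq_square)
qed

context
  fixes M :: "real measure"
  assumes sets_M: "sets M = sets borel"
    and weight: "integrable M (\<lambda>u. 1 / (u\<^sup>2 + 1))"
begin

lemma r_integrand_integrable: "integrable M (r_integrand t)"
proof (rule Bochner_Integration.integrable_bound)
  show "integrable M (\<lambda>u. (t\<^sup>2 + 2 * \<bar>t\<bar> + 4) * (1 / (u\<^sup>2 + 1)))"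
    by (intro integrable_mult_right weight)
  show "r_integrand t \<in> borel_measurable M"
    using r_integrand_measurable by (simp cong: measurable_cong_sets add: sets_M)
  show "AE u in M. norm (r_integrand t u) \<le> norm ((t\<^sup>2 + 2 * \<bar>t\<bar> + 4) * (1 / (u\<^sup>2 + 1)))"
    by (rule AE_I2) (use order_trans[OF r_integrand_bound abs_ge_self] in simp)
qed

lemma chi_in_L2: "chi t \<in> L2_space M"
proof (rule L2_spaceI)
  show m[measurable]: "chi t \<in> borel_measurable M"
    using chi_measurable by (simp cong: measurable_cong_sets add: sets_M)
  show "integrable M (\<lambda>u. (cmod (chi t u))\<^sup>2)"
  proof (rule Bochner_Integration.integrable_bound)
    show "integrable M (\<lambda>u. (\<bar>t\<bar> + 2)\<^sup>2 * (1 / (u\<^sup>2 + 1)))"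
      by (intro integrable_mult_right weight)
    have "(cmod (chi t u))\<^sup>2 \<le> (\<bar>t\<bar> + 2)\<^sup>2 * (1 / (u\<^sup>2 + 1))" for u
      using power_mono[OF chi_bound[of t u], of 2] by (simp add: power_divide)
    then show "AE u in M. norm ((cmod (chi t u))\<^sup>2) \<le> norm ((\<bar>t\<bar> + 2)\<^sup>2 * (1 / (u\<^sup>2 + 1)))"
      by (simp only: real_norm_def abs_power2) (rule AE_I2, rule order_trans[OF _ abs_ge_self])
  qed measurable
qed

lemma L2_weighted_integrable:
  assumes f: "f \<in> L2_space M"
  shows "integrable M (\<lambda>u. cmod (f u) / sqrt (u\<^sup>2 + 1))"
proof (rule Bochner_Integration.integrable_bound)
  have [measurable]: "f \<in> borel_measurable M" by (rule L2_space_measurable[OF f])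
  have [measurable]: "(\<lambda>u. u) \<in> borel_measurable M" by (simp cong: measurable_cong_sets add: sets_M)
  show "(\<lambda>u. cmod (f u) / sqrt (u\<^sup>2 + 1)) \<in> borel_measurable M" by measurable
  show "integrable M (\<lambda>u. (cmod (f u))\<^sup>2 + 1 / (u\<^sup>2 + 1))"
    by (intro Bochner_Integration.integrable_add L2_space_integrable[OF f] weight)
  have "cmod (f u) / sqrt (u\<^sup>2 + 1) \<le> (cmod (f u))\<^sup>2 + 1 / (u\<^sup>2 + 1)" for u
  proof -
    have "(1 / sqrt (u\<^sup>2 + 1))\<^sup>2 = 1 / (u\<^sup>2 + 1)" by (simp add: power_divide)
    moreover have "cmod (f u) / sqrt (u\<^sup>2 + 1) = cmod (f u) * (1 / sqrt (u\<^sup>2 + 1))"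
      "0 \<le> cmod (f u) * (1 / sqrt (u\<^sup>2 + 1))" by simp_all
    ultimately show ?thesis
      using sum_squares_bound[of "cmod (f u)" "1 / sqrt (u\<^sup>2 + 1)"] by linarith
  qed
  then show "AE u in M. norm (cmod (f u) / sqrt (u\<^sup>2 + 1)) \<le> norm ((cmod (f u))\<^sup>2 + 1 / (u\<^sup>2 + 1))"
    by simp
qed

end

lemma kernel_of_r_fun:
  assumes weight: "integrable (interval_measure \<sigma>) (\<lambda>u. 1 / (u\<^sup>2 + 1))"
  shows "kernel_of (r_fun \<sigma> r\<^sub>0 \<gamma>) t s = (\<integral>u. chi t u * cnj (chi s u) \<partial>interval_measure \<sigma>)"
proof -
  let ?M = "interval_measure \<sigma>"
  have int: "integrable ?M (r_integrand t)" for t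
    by (rule r_integrand_integrable[OF _ weight]) simp
  have r0: "r_integrand 0 = (\<lambda>_. 0)"
    by (auto simp: r_integrand_def)
  have "kernel_of (r_fun \<sigma> r\<^sub>0 \<gamma>) t s =
      - ((\<integral>u. r_integrand t u \<partial>?M) + cnj (\<integral>u. r_integrand s u \<partial>?M) - (\<integral>u. r_integrand (t - s) u \<partial>?M))"
    by (simp add: kernel_of_def r_fun_def r0 algebra_simps)
  also have "\<dots> = - (\<integral>u. r_integrand t u + cnj (r_integrand s u) - r_integrand (t - s) u \<partial>?M)"
    using int by simp
  also have "\<dots> = (\<integral>u. chi t u * cnj (chi s u) \<partial>?M)"
    unfolding r_integrand_kernel by simp
  finally show ?thesis .
qed

section \<open>Tempered distributions\<close>

lemma
  assumes "\<phi> \<in> schwartz"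
  shows schwartz_differentiable: "(vderiv ^^ n) \<phi> differentiable (at x)"
    and schwartz_bounded: "bounded (range (\<lambda>x. \<bar>x\<bar> ^ k * cmod ((vderiv ^^ n) \<phi> x)))"
  using assms by (auto simp: schwartz_def)

lemma vderiv_in_schwartz:
  assumes "\<phi> \<in> schwartz"
  shows "vderiv \<phi> \<in> schwartz"
proof -
  have "(vderiv ^^ n) (vderiv \<phi>) = (vderiv ^^ Suc n) \<phi>" for n
    by (simp only: funpow_Suc_right o_apply)
  then show ?thesis
    using assms unfolding schwartz_def by (auto simp del: funpow.simps)
qed

lemma vderiv_lincomb:
  assumes "\<phi> \<in> schwartz" "\<eta> \<in> schwartz"
  shows "(vderiv ^^ n) (\<lambda>x. a * \<phi> x + b * \<eta> x) = (\<lambda>x. a * (vderiv ^^ n) \<phi> x + b * (vderiv ^^ n) \<eta> x)"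
proof (induction n)
  case (Suc n)
  have "vderiv (\<lambda>x. a * (vderiv ^^ n) \<phi> x + b * (vderiv ^^ n) \<eta> x) x =
      a * vderiv ((vderiv ^^ n) \<phi>) x + b * vderiv ((vderiv ^^ n) \<eta>) x" for x
  proof -
    have "((vderiv ^^ n) \<phi> has_vector_derivative vderiv ((vderiv ^^ n) \<phi>) x) (at x)"
      "((vderiv ^^ n) \<eta> has_vector_derivative vderiv ((vderiv ^^ n) \<eta>) x) (at x)"
      unfolding vderiv_def[of "(vderiv ^^ n) _"] vector_derivative_works[symmetric]
      by (intro schwartz_differentiable assms)+
    then show ?thesis
      unfolding vderiv_def[of "\<lambda>x. _ x + _ x"]
      by (intro vector_derivative_at has_vector_derivative_add has_vector_derivative_mult_right)
  qed
  with Suc show ?case by auto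
qed simp

lemma schwartz_lincomb:
  assumes "\<phi> \<in> schwartz" "\<eta> \<in> schwartz"
  shows "(\<lambda>x. a * \<phi> x + b * \<eta> x) \<in> schwartz"
proof -
  have "(\<lambda>x. a * (vderiv ^^ n) \<phi> x + b * (vderiv ^^ n) \<eta> x) differentiable (at x)" for n x
    by (intro differentiable_add differentiable_mult differentiable_const schwartz_differentiable assms)
  moreover have "bounded (range (\<lambda>x. \<bar>x\<bar> ^ k * cmod (a * (vderiv ^^ n) \<phi> x + b * (vderiv ^^ n) \<eta> x)))" for k n
  proof -
    obtain A where A: "\<And>x. \<bar>x\<bar> ^ k * cmod ((vderiv ^^ n) \<phi> x) \<le> A"
      using schwartz_bounded[OF assms(1), of k n] by (auto simp: bounded_iff)
    obtain B where B: "\<And>x. \<bar>x\<bar> ^ k * cmod ((vderiv ^^ n) \<eta> x) \<le> B"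
      using schwartz_bounded[OF assms(2), of k n] by (auto simp: bounded_iff)
    have "\<bar>x\<bar> ^ k * cmod (a * (vderiv ^^ n) \<phi> x + b * (vderiv ^^ n) \<eta> x) \<le> cmod a * A + cmod b * B" for x
    proof -
      have "\<bar>x\<bar> ^ k * cmod (a * (vderiv ^^ n) \<phi> x + b * (vderiv ^^ n) \<eta> x)
          \<le> \<bar>x\<bar> ^ k * (cmod a * cmod ((vderiv ^^ n) \<phi> x) + cmod b * cmod ((vderiv ^^ n) \<eta> x))"
        by (intro mult_left_mono norm_triangle_le) (auto simp: norm_mult)
      also have "\<dots> = cmod a * (\<bar>x\<bar> ^ k * cmod ((vderiv ^^ n) \<phi> x)) + cmod b * (\<bar>x\<bar> ^ k * cmod ((vderiv ^^ n) \<eta> x))"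
        by (simp add: algebra_simps)
      also have "\<dots> \<le> cmod a * A + cmod b * B"
        by (intro add_mono mult_left_mono A B) auto
      finally show ?thesis .
    qed
    then show ?thesis
      by (intro boundedI[of _ "cmod a * A + cmod b * B"]) auto
  qed
  ultimately show ?thesis
    unfolding schwartz_def by (simp add: vderiv_lincomb[OF assms])
qed

lemma schwartz_seminorm_upper:
  assumes "\<phi> \<in> schwartz"
  shows "\<bar>x\<bar> ^ k * cmod ((vderiv ^^ n) \<phi> x) \<le> schwartz_seminorm k n \<phi>"
  unfolding schwartz_seminorm_def
  by (rule cSUP_upper) (auto intro: bounded_imp_bdd_above schwartz_bounded[OF assms])

lemma schwartz_seminorm_zero: "schwartz_seminorm k n (\<lambda>x. 0) = 0"
proof -
  have "(vderiv ^^ n) (\<lambda>x. 0) = (\<lambda>x. 0)" for n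
    by (induction n) (auto simp: vderiv_def)
  then show ?thesis by (simp add: schwartz_seminorm_def)
qed

lemma topspace_schwartz_topology: "topspace schwartz_topology = schwartz"
proof (intro equalityI subsetI)
  fix \<phi> assume "\<phi> \<in> topspace schwartz_topology"
  then show "\<phi> \<in> schwartz"
    unfolding schwartz_topology_def topology_generated_by_topspace by blast
next
  fix \<phi> assume \<phi>: "\<phi> \<in> schwartz"
  have "\<phi> \<in> {\<eta> \<in> schwartz. schwartz_seminorm 0 0 (\<lambda>x. \<eta> x - \<phi> x) < 1}"
    using \<phi> by (simp add: schwartz_seminorm_zero)
  then show "\<phi> \<in> topspace schwartz_topology"
    unfolding schwartz_topology_def topology_generated_by_topspace
    using \<phi> zero_less_one[where 'a = real] by blast
qed

text \<open>
  A linear functional bounded by finitely many seminorms is continuous: on the intersection of the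
  corresponding subbasic neighbourhoods of radius \<open>\<delta>\<close> around \<open>\<phi>\<close> it varies by at most \<open>|C| card I \<delta>\<close>.
\<close>

lemma tempered_distribution_seminorm_bound:
  assumes add: "\<And>\<phi> \<eta>. \<phi> \<in> schwartz \<Longrightarrow> \<eta> \<in> schwartz \<Longrightarrow> \<psi> (\<lambda>x. \<phi> x + \<eta> x) = \<psi> \<phi> + \<psi> \<eta>"
    and scale: "\<And>\<phi> c. \<phi> \<in> schwartz \<Longrightarrow> \<psi> (\<lambda>x. c * \<phi> x) = c * \<psi> \<phi>"
    and I: "finite I"
    and bound: "\<And>\<phi>. \<phi> \<in> schwartz \<Longrightarrow> cmod (\<psi> \<phi>) \<le> C * (\<Sum>(k, n)\<in>I. schwartz_seminorm k n \<phi>)"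
  shows "tempered_distribution \<psi>"
proof -
  have "topcontinuous_at schwartz_topology euclidean \<psi> \<phi>" if \<phi>: "\<phi> \<in> schwartz" for \<phi>
    unfolding topcontinuous_at_def
  proof (intro conjI allI impI)
    show "\<phi> \<in> topspace schwartz_topology" by (simp add: topspace_schwartz_topology \<phi>)
    show "\<psi> \<in> topspace schwartz_topology \<rightarrow> topspace euclidean" by simp
    fix V :: "complex set" assume V: "openin euclidean V \<and> \<psi> \<phi> \<in> V"
    then obtain e where e: "e > 0" "ball (\<psi> \<phi>) e \<subseteq> V"
      by (metis openE open_openin)
    define \<delta> where "\<delta> = e / (1 + \<bar>C\<bar> * card I)"
    have pos: "0 < 1 + \<bar>C\<bar> * card I" by (simp add: add_pos_nonneg)
    have \<delta>: "\<delta> > 0" using e pos by (simp add: \<delta>_def)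
    define B where "B = (\<lambda>(k, n). {\<eta> \<in> schwartz. schwartz_seminorm k n (\<lambda>x. \<eta> x - \<phi> x) < \<delta>})"
    define U where "U = topspace schwartz_topology \<inter> \<Inter> (B ` I)"
    have B_open: "openin schwartz_topology (B p)" for p
      unfolding schwartz_topology_def B_def using \<delta> \<phi>
      by (intro topology_generated_by_Basis) (auto split: prod.split)
    have "openin schwartz_topology U"
      unfolding U_def by (rule openin_Int_Inter) (use I B_open in auto)
    moreover have "\<phi> \<in> U"
      using \<phi> \<delta> by (auto simp: U_def B_def topspace_schwartz_topology schwartz_seminorm_zero)
    moreover have "\<psi> \<eta> \<in> V" if "\<eta> \<in> U" for \<eta>
    proof -
      have \<eta>: "\<eta> \<in> schwartz" using that by (simp add: U_def topspace_schwartz_topology)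
      have diff: "(\<lambda>x. \<eta> x - \<phi> x) \<in> schwartz"
        using schwartz_lincomb[OF \<eta> \<phi>, of 1 "- 1"] by simp
      have neg: "(\<lambda>x. - 1 * \<phi> x) \<in> schwartz"
        using schwartz_lincomb[OF \<phi> \<phi>, of "- 1" 0] by simp
      have "\<psi> (\<lambda>x. \<eta> x - \<phi> x) = \<psi> (\<lambda>x. \<eta> x + (- 1) * \<phi> x)" by simp
      also have "\<dots> = \<psi> \<eta> - \<psi> \<phi>"
        unfolding add[OF \<eta> neg] scale[OF \<phi>] by simp
      finally have "cmod (\<psi> \<eta> - \<psi> \<phi>) \<le> C * (\<Sum>(k, n)\<in>I. schwartz_seminorm k n (\<lambda>x. \<eta> x - \<phi> x))"
        using bound[OF diff] by simp
      also have "\<dots> \<le> \<bar>C\<bar> * (\<Sum>(k, n)\<in>I. \<delta>)"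
      proof (rule mult_mono)
        have "schwartz_seminorm k n (\<lambda>x. \<eta> x - \<phi> x) \<le> \<delta>" if "(k, n) \<in> I" for k n
          using that \<open>\<eta> \<in> U\<close> by (force simp: U_def B_def)
        then show "(\<Sum>(k, n)\<in>I. schwartz_seminorm k n (\<lambda>x. \<eta> x - \<phi> x)) \<le> (\<Sum>(k, n)\<in>I. \<delta>)"
          by (intro sum_mono) auto
        have "0 \<le> schwartz_seminorm k n (\<lambda>x. \<eta> x - \<phi> x)" for k n
          by (rule order_trans[OF _ schwartz_seminorm_upper[OF diff, of 0]]) simp
        then show "0 \<le> (\<Sum>(k, n)\<in>I. schwartz_seminorm k n (\<lambda>x. \<eta> x - \<phi> x))"
          by (intro sum_nonneg) auto
      qed auto
      also have "\<dots> = \<bar>C\<bar> * card I * \<delta>"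
        by (simp add: case_prod_unfold)
      also have "\<dots> < (1 + \<bar>C\<bar> * card I) * \<delta>"
        using \<delta> by (simp add: algebra_simps)
      also have "\<dots> = e" using pos by (simp add: \<delta>_def)
      finally show ?thesis
        using e(2) by (auto simp: dist_norm norm_minus_commute)
    qed
    ultimately show "\<exists>U. openin schwartz_topology U \<and> \<phi> \<in> U \<and> (\<forall>y\<in>U. \<psi> y \<in> V)" by blast
  qed
  then show ?thesis
    unfolding tempered_distribution_def continuous_map_eq_topcontinuous_at
    using add scale by (simp add: topspace_schwartz_topology)
qed

lemma schwartz_isCont: "\<phi> \<in> schwartz \<Longrightarrow> isCont \<phi> x"
  using schwartz_differentiable[of \<phi> 0 x] by (simp add: differentiable_imp_continuous_within)

lemma schwartz_measurable: "\<phi> \<in> schwartz \<Longrightarrow> \<phi> \<in> borel_measurable borel"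
  by (intro borel_measurable_continuous_onI continuous_at_imp_continuous_on ballI schwartz_isCont)

lemma schwartz_decay:
  assumes "\<phi> \<in> schwartz"
  shows "cmod (\<phi> x) \<le> (schwartz_seminorm 0 0 \<phi> + schwartz_seminorm m 0 \<phi>) / (1 + \<bar>x\<bar> ^ m)"
proof -
  have pos: "0 < 1 + \<bar>x\<bar> ^ m" by (simp add: add_pos_nonneg)
  have "cmod (\<phi> x) * (1 + \<bar>x\<bar> ^ m) \<le> schwartz_seminorm 0 0 \<phi> + schwartz_seminorm m 0 \<phi>"
    using schwartz_seminorm_upper[OF assms, of x 0 0] schwartz_seminorm_upper[OF assms, of x m 0]
    by (simp add: algebra_simps)
  then show ?thesis using pos by (simp add: pos_le_divide_eq)
qed

text \<open>
  A Schwartz function is \<open>O(1 / (1 + |x|\<^sup>m))\<close> with a constant controlled by two seminorms, which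
  dominates the pairing by the weighted integral of \<open>|f|\<close>.
\<close>

lemma defines_tempered_distribution_polynomial_weight:
  assumes sets_M: "sets M = sets borel" and f[measurable]: "f \<in> borel_measurable M"
    and int: "integrable M (\<lambda>x. cmod (f x) / (1 + \<bar>x\<bar> ^ m))"
  shows "defines_tempered_distribution M f"
proof -
  have bound: "cmod (f x * \<phi> x) \<le> (schwartz_seminorm 0 0 \<phi> + schwartz_seminorm m 0 \<phi>) * (cmod (f x) / (1 + \<bar>x\<bar> ^ m))"
    if "\<phi> \<in> schwartz" for \<phi> x
    using mult_left_mono[OF schwartz_decay[OF that, of x m], of "cmod (f x)"]
    by (simp add: norm_mult mult_ac)
  have int_prod: "integrable M (\<lambda>x. f x * \<phi> x)" if \<phi>: "\<phi> \<in> schwartz" for \<phi>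
  proof (rule Bochner_Integration.integrable_bound)
    show "integrable M (\<lambda>x. (schwartz_seminorm 0 0 \<phi> + schwartz_seminorm m 0 \<phi>) * (cmod (f x) / (1 + \<bar>x\<bar> ^ m)))"
      by (intro integrable_mult_right int)
    have [measurable]: "\<phi> \<in> borel_measurable M"
      using schwartz_measurable[OF \<phi>] by (simp cong: measurable_cong_sets add: sets_M)
    show "(\<lambda>x. f x * \<phi> x) \<in> borel_measurable M" by measurable
    show "AE x in M. norm (f x * \<phi> x) \<le> norm ((schwartz_seminorm 0 0 \<phi> + schwartz_seminorm m 0 \<phi>) * (cmod (f x) / (1 + \<bar>x\<bar> ^ m)))"
      by (rule AE_I2) (use order_trans[OF bound[OF \<phi>] abs_ge_self] in simp)
  qed
  have "tempered_distribution (dist_of M f)"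
  proof (rule tempered_distribution_seminorm_bound[where I = "{(0, 0), (m, 0)}"])
    show "dist_of M f (\<lambda>x. \<phi> x + \<eta> x) = dist_of M f \<phi> + dist_of M f \<eta>"
      if "\<phi> \<in> schwartz" "\<eta> \<in> schwartz" for \<phi> \<eta>
      using int_prod[OF that(1)] int_prod[OF that(2)] by (simp add: dist_of_def distrib_left)
    show "dist_of M f (\<lambda>x. c * \<phi> x) = c * dist_of M f \<phi>" for \<phi> c
      by (simp add: dist_of_def mult.left_commute)
    show "finite {(0, 0), (m, 0)}" by simp
    fix \<phi> assume \<phi>: "\<phi> \<in> schwartz"
    let ?W = "\<integral>x. cmod (f x) / (1 + \<bar>x\<bar> ^ m) \<partial>M"
    let ?p = "\<lambda>k. schwartz_seminorm k 0 \<phi>"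
    have p: "0 \<le> ?p k" for k
      by (rule order_trans[OF _ schwartz_seminorm_upper[OF \<phi>, of 0]]) simp
    have W: "0 \<le> ?W" by (intro integral_nonneg_AE AE_I2) (simp add: add_nonneg_nonneg)
    have "cmod (dist_of M f \<phi>) \<le> (\<integral>x. (?p 0 + ?p m) * (cmod (f x) / (1 + \<bar>x\<bar> ^ m)) \<partial>M)"
      unfolding dist_of_def
      by (rule order_trans[OF integral_norm_bound integral_mono])
         (intro integrable_norm int_prod \<phi> integrable_mult_right int bound)+
    also have "\<dots> = ?W * (?p 0 + ?p m)"
      by (subst integral_mult_right_zero) (rule mult.commute)
    \<comment> \<open>For \<open>m = 0\<close> the two seminorms coincide and the set of indices has one element; hence the factor 2.\<close>
    also have "\<dots> \<le> (2 * ?W) * (\<Sum>(k, n)\<in>{(0, 0), (m, 0)}. schwartz_seminorm k n \<phi>)"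
    proof (cases "m = 0")
      case True
      then show ?thesis by simp
    next
      case False
      have "?W * (?p 0 + ?p m) \<le> (2 * ?W) * (?p 0 + ?p m)"
        using W p by (intro mult_right_mono) auto
      then show ?thesis using False by simp
    qed
    finally show "cmod (dist_of M f \<phi>) \<le> (2 * ?W) * (\<Sum>(k, n)\<in>{(0, 0), (m, 0)}. schwartz_seminorm k n \<phi>)" .
  qed
  with int_prod show ?thesis
    by (simp add: defines_tempered_distribution_def)
qed

lemma integrable_inverse_1_plus_square: "integrable lborel (\<lambda>x::real. 1 / (1 + x\<^sup>2))"
proof -
  have "set_integrable lborel (einterval (- \<infinity>) \<infinity>) (\<lambda>x::real. 1 / (1 + x\<^sup>2))"
  proof (rule interval_integral_FTC_nonneg)
    show "((arctan \<circ> real_of_ereal) \<longlongrightarrow> - (pi/2)) (at_right (- \<infinity>))"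
      "((arctan \<circ> real_of_ereal) \<longlongrightarrow> pi/2) (at_left \<infinity>)"
      using tendsto_arctan_at_bot tendsto_arctan_at_top by (simp_all add: ereal_tendsto_simps)
    show "DERIV arctan x :> 1 / (1 + x\<^sup>2)" for x
      using DERIV_arctan[of x] by (simp add: field_simps inverse_eq_divide)
    show "isCont (\<lambda>x. 1 / (1 + x\<^sup>2)) x" for x :: real
      by (intro continuous_intros) (simp add: add_pos_nonneg less_imp_neq[symmetric])
  qed (auto simp: add_nonneg_nonneg)
  then show ?thesis by (simp add: set_integrable_def)
qed

text \<open>
  The weight \<open>1 + |t|\<^sup>3\<close> makes the quotient \<open>O(1 / (1 + t\<^sup>2))\<close>.
\<close>

lemma defines_tempered_distribution_linear_growth:
  assumes f: "f \<in> borel_measurable borel" and growth: "\<And>t. cmod (f t) \<le> C * (\<bar>t\<bar> + 2)"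
  shows "defines_tempered_distribution lborel f"
proof (rule defines_tempered_distribution_polynomial_weight[where m = 3])
  show "integrable lborel (\<lambda>t. cmod (f t) / (1 + \<bar>t\<bar> ^ 3))"
  proof (rule Bochner_Integration.integrable_bound)
    show "integrable lborel (\<lambda>t. \<bar>C\<bar> * 4 * (1 / (1 + t\<^sup>2)))"
      by (intro integrable_mult_right integrable_inverse_1_plus_square)
    show "(\<lambda>t. cmod (f t) / (1 + \<bar>t\<bar> ^ 3)) \<in> borel_measurable lborel"
      using f by simp
    have "cmod (f t) / (1 + \<bar>t\<bar> ^ 3) \<le> \<bar>C\<bar> * 4 * (1 / (1 + t\<^sup>2))" for t
    proof -
      define a where "a = \<bar>t\<bar>"
      have a: "a \<ge> 0" "t\<^sup>2 = a\<^sup>2" by (auto simp: a_def)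
      have pos: "0 < 1 + a ^ 3" "0 < 1 + a\<^sup>2" using a by (auto intro: add_pos_nonneg)
      have "0 \<le> (1 - a)\<^sup>2 * (1 + a)" using a by simp
      also have "(1 - a)\<^sup>2 * (1 + a) = 1 - a - a\<^sup>2 + a ^ 3"
        by (simp add: power2_eq_square power3_eq_cube algebra_simps)
      finally have cubic: "a + a\<^sup>2 \<le> 1 + a ^ 3" by simp
      have "(a + 2) * (1 + a\<^sup>2) = 2 + a + 2 * a\<^sup>2 + a ^ 3"
        by (simp add: power2_eq_square power3_eq_cube algebra_simps)
      also have "\<dots> \<le> 4 * (1 + a ^ 3)"
      proof -
        have "a + 2 * a\<^sup>2 \<le> 2 + 3 * a ^ 3"
          using cubic a(1) zero_le_power[OF a(1), of 3] by linarith
        then show ?thesis by (simp add: algebra_simps)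
      qed
      finally have "(a + 2) / (1 + a ^ 3) \<le> 4 * (1 / (1 + a\<^sup>2))"
        using pos by (simp add: field_simps)
      then have "\<bar>C\<bar> * ((a + 2) / (1 + a ^ 3)) \<le> \<bar>C\<bar> * (4 * (1 / (1 + a\<^sup>2)))"
        by (intro mult_left_mono) auto
      moreover have "cmod (f t) \<le> \<bar>C\<bar> * (a + 2)"
        using order_trans[OF growth[of t] mult_right_mono[OF abs_ge_self[of C]]] a(1) by (simp add: a_def)
      then have "cmod (f t) / (1 + a ^ 3) \<le> \<bar>C\<bar> * (a + 2) / (1 + a ^ 3)"
        using pos by (intro divide_right_mono) auto
      ultimately show ?thesis unfolding a(2) a_def[symmetric] by simp
    qed
    then show "AE t in lborel. norm (cmod (f t) / (1 + \<bar>t\<bar> ^ 3)) \<le> norm (\<bar>C\<bar> * 4 * (1 / (1 + t\<^sup>2)))"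
      by simp
  qed
qed (use f in auto)

section \<open>The derivative of the transform\<close>

lemma chi_has_vector_derivative:
  "((\<lambda>t. chi t u) has_vector_derivative exp (\<i> * of_real u * of_real t)) (at t)"
proof (cases "u = 0")
  case True
  have "((\<lambda>t. complex_of_real t) has_vector_derivative 1) (at t)"
    using has_vector_derivative_of_real[OF DERIV_ident] by simp
  with True show ?thesis by (simp add: chi_def)
next
  case False
  have "((\<lambda>z. (exp (\<i> * z * of_real u) - 1) / (\<i> * of_real u)) has_field_derivative
      exp (\<i> * of_real u * of_real t)) (at (of_real t))"
    using False by (auto intro!: derivative_eq_intros simp: mult_ac)
  from has_vector_derivative_real_field[OF this] False show ?thesis
    by (simp add: chi_def)
qed

lemma integrable_linear_growth_schwartz:
  assumes "\<phi> \<in> schwartz" "f \<in> borel_measurable borel" "\<And>t. cmod (f t) \<le> C * (\<bar>t\<bar> + 2)"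
  shows "integrable lborel (\<lambda>t. f t * \<phi> t)"
  using defines_tempered_distribution_linear_growth[OF assms(2,3)] assms(1)
  by (simp add: defines_tempered_distribution_def)

lemma chi_linear_growth: "cmod (chi t u) \<le> 1 * (\<bar>t\<bar> + 2)"
proof -
  have "(\<bar>t\<bar> + 2) / sqrt (u\<^sup>2 + 1) \<le> (\<bar>t\<bar> + 2) / 1"
    by (intro divide_left_mono) (auto intro: add_nonneg_pos)
  then show ?thesis using chi_bound[of t u] by simp
qed

lemma chi_measurable_left: "(\<lambda>t. chi t u) \<in> borel_measurable borel"
  using measurable_compose[OF measurable_Pair2'[of u borel borel] chi_measurable_pair] by simp

lemma schwartz_tendsto_zero_linear:
  assumes \<phi>: "\<phi> \<in> schwartz" and growth: "\<And>t. cmod (f t) \<le> \<bar>t\<bar> + 2"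
  shows "((\<lambda>t. f t * \<phi> t) \<longlongrightarrow> 0) at_top" "((\<lambda>t. f t * \<phi> t) \<longlongrightarrow> 0) at_bot"
proof -
  define B where "B = schwartz_seminorm 0 0 \<phi> + schwartz_seminorm 2 0 \<phi>"
  have "cmod (f t * \<phi> t) \<le> (\<bar>t\<bar> + 2) * (B / (1 + \<bar>t\<bar> ^ 2))" for t
    unfolding norm_mult B_def
    by (intro mult_mono growth schwartz_decay[OF \<phi>]) auto
  then have bound: "\<forall>\<^sub>F t in F. norm (f t * \<phi> t) \<le> B * ((\<bar>t\<bar> + 2) / (1 + \<bar>t\<bar> ^ 2))" for F
    by (simp add: mult.commute)
  have top: "((\<lambda>t::real. (t + 2) / (1 + t ^ 2)) \<longlongrightarrow> 0) at_top"
    by real_asymp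
  have abs_top: "filterlim (\<lambda>t::real. \<bar>t\<bar>) at_top at_top" "filterlim (\<lambda>t::real. \<bar>t\<bar>) at_top at_bot"
    by (rule filterlim_abs_real, rule filterlim_compose[OF filterlim_abs_real filterlim_uminus_at_top_at_bot, simplified])
  show "((\<lambda>t. f t * \<phi> t) \<longlongrightarrow> 0) at_top"
    by (rule Lim_null_comparison[OF bound])
       (use tendsto_mult_left[OF filterlim_compose[OF top abs_top(1)], of B] in simp)
  show "((\<lambda>t. f t * \<phi> t) \<longlongrightarrow> 0) at_bot"
    by (rule Lim_null_comparison[OF bound])
       (use tendsto_mult_left[OF filterlim_compose[OF top abs_top(2)], of B] in simp)
qed

text \<open>
  The product \<open>chi t u * \<phi> t\<close> vanishes at both ends of the line, because \<open>chi\<close> grows at most linearly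
  in \<open>t\<close> and \<open>\<phi>\<close> decays rapidly.
\<close>

lemma chi_integration_by_parts:
  assumes \<phi>: "\<phi> \<in> schwartz"
  shows "(\<integral>t. chi t u * vderiv \<phi> t \<partial>lborel) = - (\<integral>t. exp (\<i> * of_real u * of_real t) * \<phi> t \<partial>lborel)"
proof -
  let ?e = "\<lambda>t. exp (\<i> * of_real u * of_real t) :: complex"
  have \<phi>': "vderiv \<phi> \<in> schwartz" by (rule vderiv_in_schwartz[OF \<phi>])
  have e_norm: "cmod (?e t) = 1" for t
    by (simp add: norm_exp_eq_Re)
  have int1: "integrable lborel (\<lambda>t. chi t u * vderiv \<phi> t)"
    by (rule integrable_linear_growth_schwartz[OF \<phi>' chi_measurable_left chi_linear_growth])
  have int2: "integrable lborel (\<lambda>t. ?e t * \<phi> t)"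
    by (rule integrable_linear_growth_schwartz[OF \<phi>, where C = 1]) (simp_all add: e_norm)
  have deriv: "((\<lambda>t. chi t u * \<phi> t) has_vector_derivative (chi t u * vderiv \<phi> t + ?e t * \<phi> t)) (at t)" for t
  proof (rule has_vector_derivative_mult[OF chi_has_vector_derivative])
    show "(\<phi> has_vector_derivative vderiv \<phi> t) (at t)"
      unfolding vderiv_def vector_derivative_works[symmetric]
      using schwartz_differentiable[OF \<phi>, of 0] by simp
  qed
  have lim: "((\<lambda>t. chi t u * \<phi> t) \<longlongrightarrow> 0) at_top" "((\<lambda>t. chi t u * \<phi> t) \<longlongrightarrow> 0) at_bot"
    by (rule schwartz_tendsto_zero_linear[OF \<phi>], use chi_linear_growth in simp)+
  have "(LBINT t=-\<infinity>..\<infinity>. chi t u * vderiv \<phi> t + ?e t * \<phi> t) = 0 - 0"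
  proof (rule interval_integral_FTC_integrable)
    show "isCont (\<lambda>t. chi t u * vderiv \<phi> t + ?e t * \<phi> t) t" for t
      by (intro continuous_intros schwartz_isCont \<phi> \<phi>'
          has_vector_derivative_continuous[OF chi_has_vector_derivative])
    show "set_integrable lborel (einterval (- \<infinity>) \<infinity>) (\<lambda>t. chi t u * vderiv \<phi> t + ?e t * \<phi> t)"
      using int1 int2 by (simp add: set_integrable_def)
  qed (use deriv lim in \<open>simp_all add: ereal_tendsto_simps\<close>)
  then have "(\<integral>t. chi t u * vderiv \<phi> t + ?e t * \<phi> t \<partial>lborel) = 0"
    by (simp add: interval_lebesgue_integral_def set_lebesgue_integral_def)
  then show ?thesis
    using int1 int2 by (simp add: eq_neg_iff_add_eq_0)
qed

lemma L2_defines: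
  fixes M :: "real measure"
  assumes sets_M: "sets M = sets borel"
    and weight: "integrable M (\<lambda>u. 1 / (u\<^sup>2 + 1))"
    and f: "f \<in> L2_space M"
  shows "defines_tempered_distribution M f"
proof (rule defines_tempered_distribution_polynomial_weight[OF sets_M L2_space_measurable[OF f], where m = 2])
  show "integrable M (\<lambda>x. cmod (f x) / (1 + \<bar>x\<bar> ^ 2))"
  proof (rule Bochner_Integration.integrable_bound[OF L2_weighted_integrable[OF sets_M weight f]])
    have [measurable]: "f \<in> borel_measurable M" "(\<lambda>u. u) \<in> borel_measurable M"
      using L2_space_measurable[OF f] by (simp_all cong: measurable_cong_sets add: sets_M)
    show "(\<lambda>x. cmod (f x) / (1 + \<bar>x\<bar> ^ 2)) \<in> borel_measurable M" by measurable
    have "sqrt (x\<^sup>2 + 1) \<le> 1 + x\<^sup>2" for x :: real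
      by (rule real_le_lsqrt) (auto simp: power2_sum)
    then have "cmod (f x) / (1 + \<bar>x\<bar> ^ 2) \<le> cmod (f x) / sqrt (x\<^sup>2 + 1)" for x
      by (intro divide_left_mono mult_pos_pos) (simp_all add: add_pos_nonneg add_nonneg_pos)
    then show "AE x in M. norm (cmod (f x) / (1 + \<bar>x\<bar> ^ 2)) \<le> norm (cmod (f x) / sqrt (x\<^sup>2 + 1))"
      by simp
  qed
qed

context
  fixes M :: "real measure" and f :: "real \<Rightarrow> complex"
  assumes sigma_finite: "sigma_finite_measure M"
    and sets_M: "sets M = sets borel"
    and weight: "integrable M (\<lambda>u. 1 / (u\<^sup>2 + 1))"
    and f: "f \<in> L2_space M"
begin

lemma chi_transform_growth:
  "cmod (\<integral>u. chi t u * f u \<partial>M) \<le> (\<integral>u. cmod (f u) / sqrt (u\<^sup>2 + 1) \<partial>M) * (\<bar>t\<bar> + 2)"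
  and chi_transform_integrand_bound:
  "(\<integral>u. cmod (chi t u * f u) \<partial>M) \<le> (\<integral>u. cmod (f u) / sqrt (u\<^sup>2 + 1) \<partial>M) * (\<bar>t\<bar> + 2)"
  and chi_transform_integrable: "integrable M (\<lambda>u. chi t u * f u)"
proof -
  have bound: "cmod (chi t u * f u) \<le> (\<bar>t\<bar> + 2) * (cmod (f u) / sqrt (u\<^sup>2 + 1))" for u
    using mult_right_mono[OF chi_bound[of t u], of "cmod (f u)"] by (simp add: norm_mult)
  have int: "integrable M (\<lambda>u. (\<bar>t\<bar> + 2) * (cmod (f u) / sqrt (u\<^sup>2 + 1)))"
    by (intro integrable_mult_right L2_weighted_integrable[OF sets_M weight f])
  have [measurable]: "f \<in> borel_measurable M" "chi t \<in> borel_measurable M"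
    using L2_space_measurable[OF f] L2_space_measurable[OF chi_in_L2[OF sets_M weight]] by auto
  show *: "integrable M (\<lambda>u. chi t u * f u)"
    by (rule Bochner_Integration.integrable_bound[OF int])
       (measurable, rule AE_I2, use order_trans[OF bound abs_ge_self] in simp)
  have "(\<integral>u. cmod (chi t u * f u) \<partial>M) \<le> (\<integral>u. (\<bar>t\<bar> + 2) * (cmod (f u) / sqrt (u\<^sup>2 + 1)) \<partial>M)"
    by (intro integral_mono integrable_norm * int bound)
  also have "\<dots> = (\<integral>u. cmod (f u) / sqrt (u\<^sup>2 + 1) \<partial>M) * (\<bar>t\<bar> + 2)"
    by (subst integral_mult_right_zero) (rule mult.commute)
  finally show **: "(\<integral>u. cmod (chi t u * f u) \<partial>M) \<le> (\<integral>u. cmod (f u) / sqrt (u\<^sup>2 + 1) \<partial>M) * (\<bar>t\<bar> + 2)" .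
  show "cmod (\<integral>u. chi t u * f u \<partial>M) \<le> (\<integral>u. cmod (f u) / sqrt (u\<^sup>2 + 1) \<partial>M) * (\<bar>t\<bar> + 2)"
    by (rule order_trans[OF integral_norm_bound **])
qed

lemma chi_f_measurable_pair:
  "(\<lambda>(t, u). chi t u * f u) \<in> borel_measurable (borel \<Otimes>\<^sub>M M)"
proof -
  have [measurable]: "f \<in> borel_measurable M" by (rule L2_space_measurable[OF f])
  have "sets (borel \<Otimes>\<^sub>M M) = sets (borel \<Otimes>\<^sub>M (borel :: real measure))"
    by (rule sets_pair_measure_cong[OF refl sets_M])
  note cong = measurable_cong_sets[OF this refl]
  have [measurable]: "(\<lambda>p. chi (fst p) (snd p)) \<in> borel_measurable (borel \<Otimes>\<^sub>M M)"
    unfolding cong using chi_measurable_pair by (simp add: case_prod_unfold)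
  show ?thesis
    unfolding case_prod_unfold by measurable
qed

lemma chi_transform_measurable: "(\<lambda>t. \<integral>u. chi t u * f u \<partial>M) \<in> borel_measurable borel"
  using sigma_finite_measure.borel_measurable_lebesgue_integral[OF sigma_finite chi_f_measurable_pair] .

lemma chi_transform_defines: "defines_tempered_distribution lborel (\<lambda>t. \<integral>u. chi t u * f u \<partial>M)"
  by (rule defines_tempered_distribution_linear_growth[OF chi_transform_measurable chi_transform_growth])

text \<open>
  Exchange the integrals over \<open>t\<close> and \<open>u\<close>, then integrate by parts in \<open>t\<close> for fixed \<open>u\<close>.
\<close>

lemma chi_transform_deriv:
  assumes \<phi>: "\<phi> \<in> schwartz"
  shows "dist_deriv (dist_of lborel (\<lambda>t. \<integral>u. chi t u * f u \<partial>M)) \<phi> =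
    2 * of_real pi * dist_inv_fourier (dist_of M f) \<phi>"
proof -
  interpret M: sigma_finite_measure M by (rule sigma_finite)
  interpret pair_sigma_finite lborel M ..
  let ?C = "\<integral>u. cmod (f u) / sqrt (u\<^sup>2 + 1) \<partial>M"
  let ?h = "\<lambda>t u. chi t u * f u * vderiv \<phi> t"
  have \<phi>': "vderiv \<phi> \<in> schwartz" by (rule vderiv_in_schwartz[OF \<phi>])
  have sets_pair: "sets (lborel \<Otimes>\<^sub>M M) = sets (borel \<Otimes>\<^sub>M M)"
    by (rule sets_pair_measure_cong) simp_all
  have [measurable]: "vderiv \<phi> \<in> borel_measurable borel" by (rule schwartz_measurable[OF \<phi>'])
  have [measurable]: "(\<lambda>p. chi (fst p) (snd p) * f (snd p)) \<in> borel_measurable (lborel \<Otimes>\<^sub>M M)"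
    using chi_f_measurable_pair by (simp add: case_prod_unfold sets_pair cong: measurable_cong_sets)
  have [measurable]: "(\<lambda>(t, u). ?h t u) \<in> borel_measurable (lborel \<Otimes>\<^sub>M M)"
    unfolding case_prod_unfold by measurable
  have meas_norm: "(\<lambda>t. complex_of_real (\<integral>u. cmod (chi t u * f u) \<partial>M)) \<in> borel_measurable borel"
  proof -
    have "(\<lambda>(t, u). cmod (chi t u * f u)) \<in> borel_measurable (borel \<Otimes>\<^sub>M M)"
      using measurable_compose[OF chi_f_measurable_pair borel_measurable_norm] by (simp add: case_prod_unfold)
    from M.borel_measurable_lebesgue_integral[OF this] show ?thesis by measurable
  qed
  have norm_growth: "cmod (complex_of_real (\<integral>u. cmod (chi t u * f u) \<partial>M)) \<le> ?C * (\<bar>t\<bar> + 2)" for t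
    using chi_transform_integrand_bound[of t] by (simp only: norm_of_real abs_of_nonneg[OF Bochner_Integration.integral_nonneg[OF norm_ge_zero]])
  have "integrable lborel (\<lambda>t. complex_of_real (\<integral>u. cmod (chi t u * f u) \<partial>M) * vderiv \<phi> t)"
    by (rule integrable_linear_growth_schwartz[OF \<phi>' meas_norm norm_growth])
  \<comment> \<open>The absolute inner integral grows at most linearly in \<open>t\<close>, so Tonelli's criterion holds.\<close>
  from integrable_norm[OF this]
  have int_norm: "integrable lborel (\<lambda>t. \<integral>u. cmod (?h t u) \<partial>M)"
    by (simp add: norm_mult)
  have int: "integrable (lborel \<Otimes>\<^sub>M M) (\<lambda>(t, u). ?h t u)"
  proof (rule Fubini_integrable)
    show "integrable lborel (\<lambda>t. \<integral>u. norm (case (t, u) of (t, u) \<Rightarrow> ?h t u) \<partial>M)"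
      using int_norm by simp
    show "AE t in lborel. integrable M (\<lambda>u. case (t, u) of (t, u) \<Rightarrow> ?h t u)"
      using chi_transform_integrable by (simp add: integrable_mult_left)
  qed measurable
  have "dist_deriv (dist_of lborel (\<lambda>t. \<integral>u. chi t u * f u \<partial>M)) \<phi> = - (\<integral>t. (\<integral>u. ?h t u \<partial>M) \<partial>lborel)"
    by (simp add: dist_deriv_def dist_of_def)
  also have "(\<integral>t. (\<integral>u. ?h t u \<partial>M) \<partial>lborel) = (\<integral>u. (\<integral>t. ?h t u \<partial>lborel) \<partial>M)"
    by (rule Fubini_integral[OF int, symmetric])
  also have "\<dots> = (\<integral>u. - (2 * of_real pi) * (f u * inv_fourier \<phi> u) \<partial>M)"
  proof (rule Bochner_Integration.integral_cong[OF refl])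
    fix u
    have "(\<integral>t. ?h t u \<partial>lborel) = (\<integral>t. f u * (chi t u * vderiv \<phi> t) \<partial>lborel)"
      by (simp add: mult_ac)
    also have "\<dots> = f u * - (\<integral>t. exp (\<i> * of_real u * of_real t) * \<phi> t \<partial>lborel)"
      by (simp only: integral_mult_right_zero chi_integration_by_parts[OF \<phi>])
    also have "\<dots> = - (2 * of_real pi) * (f u * inv_fourier \<phi> u)"
      by (simp add: inv_fourier_def)
    finally show "(\<integral>t. ?h t u \<partial>lborel) = - (2 * of_real pi) * (f u * inv_fourier \<phi> u)" .
  qed
  also have "- \<dots> = 2 * of_real pi * dist_inv_fourier (dist_of M f) \<phi>"
    by (simp only: integral_mult_right_zero) (simp add: dist_inv_fourier_def dist_of_def)
  finally show ?thesis .
qed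

end

section \<open>The space associated with the spectral kernel\<close>

text \<open>
  \<open>cnj (chi t) = - chi (- t)\<close>, and the interval is symmetric.
\<close>

lemma cnj_chi_closed_span:
  "L2_closed_span M ((\<lambda>y u. cnj (chi y u)) ` {-T..T}) = L2_closed_span M {chi t | t. \<bar>t\<bar> \<le> T}"
proof (rule L2_closed_span_eqI; rule subsetI)
  have neg: "(\<lambda>u. - g u) \<in> fun_span S" if "g \<in> S" for g and S :: "(real \<Rightarrow> complex) set"
    using fun_span_lincomb[OF fun_span_base fun_span_base, OF that that, of "- 1" 0] by (simp add: lincomb_UNIV)
  show "g \<in> fun_span {chi t | t. \<bar>t\<bar> \<le> T}" if g: "g \<in> (\<lambda>y u. cnj (chi y u)) ` {-T..T}" for g
  proof -
    obtain y where y: "y \<in> {-T..T}" "g = (\<lambda>u. - chi (- y) u)"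
      using g by (auto simp: cnj_chi)
    then show ?thesis
      unfolding y(2) by (intro neg) auto
  qed
  show "g \<in> fun_span ((\<lambda>y u. cnj (chi y u)) ` {-T..T})" if g: "g \<in> {chi t | t. \<bar>t\<bar> \<le> T}" for g
  proof -
    obtain t where t: "\<bar>t\<bar> \<le> T" "g = chi t" using g by blast
    have "g = (\<lambda>u. - (\<lambda>u. cnj (chi (- t) u)) u)"
      by (simp add: t(2) cnj_chi)
    then show ?thesis
      using t(1) by (simp only:) (intro neg imageI, auto)
  qed
qed

theorem theorem2p3:
  fixes \<sigma> :: "real \<Rightarrow> real" and r\<^sub>0 \<gamma> T :: real
  assumes "mono \<sigma>"
    and "\<And>a. continuous (at_right a) \<sigma>"
    and "integrable (interval_measure \<sigma>) (\<lambda>u. 1 / (u\<^sup>2 + 1))"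
    and "0 < T"
  shows "(\<exists>H ip. rkhs {-T..T} H ip (kernel_of (r_fun \<sigma> r\<^sub>0 \<gamma>))) \<and>
    (\<forall>H ip. rkhs {-T..T} H ip (kernel_of (r_fun \<sigma> r\<^sub>0 \<gamma>)) \<longrightarrow>
       H = {restrict (chi_transform \<sigma> f) {-T..T} | f. f \<in> chi_span \<sigma> T} \<and>
       (\<forall>f\<in>chi_span \<sigma> T.
          ip_norm ip (restrict (chi_transform \<sigma> f) {-T..T}) = L2_norm (interval_measure \<sigma>) f)) \<and>
    (\<forall>f\<in>chi_span \<sigma> T.
       defines_tempered_distribution lborel (chi_transform \<sigma> f) \<and>
       defines_tempered_distribution (interval_measure \<sigma>) f \<and>
       (\<forall>\<phi>\<in>schwartz.
          dist_deriv (dist_of lborel (chi_transform \<sigma> f)) \<phi> =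
          2 * of_real pi * dist_inv_fourier (dist_of (interval_measure \<sigma>) f) \<phi>))"
proof -
  let ?M = "interval_measure \<sigma>" and ?X = "{-T..T}"
  let ?K = "kernel_of (r_fun \<sigma> r\<^sub>0 \<gamma>)"
  \<comment> \<open>Inner products are conjugate linear in the second argument, so the transform \<open>\<integral> chi t * f d\<sigma>\<close> is the inner product of \<open>f\<close> with \<open>cnj (chi t)\<close>.\<close>
  define k where "k = (\<lambda>y u. cnj (chi y u))"
  let ?V = "\<lambda>f. restrict (chi_transform \<sigma> f) ?X"
  have sets_M: "sets ?M = sets borel" by simp
  have sf: "sigma_finite_measure ?M"
    by (rule sigma_finite_interval_measure) (use assms(1,2) in \<open>auto simp: mono_def\<close>)
  have k_L2: "k y \<in> L2_space ?M" for y
    using L2_space_lincomb[OF chi_in_L2[OF sets_M assms(3), of "- y"] chi_in_L2[OF sets_M assms(3), of "- y"], of "- 1" 0]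
    by (simp add: k_def cnj_chi lincomb_UNIV)
  have span: "L2_closed_span ?M (k ` ?X) = chi_span \<sigma> T"
    unfolding k_def chi_span_def by (rule cnj_chi_closed_span)
  have V: "(\<lambda>x\<in>?X. L2_ip ?M f (k x)) = ?V f" for f
    by (rule restrict_ext) (simp add: L2_ip_def k_def chi_transform_def mult.commute)
  have K: "(\<lambda>x y. L2_ip ?M (k y) (k x)) = ?K"
    by (intro ext) (simp add: kernel_of_r_fun[OF assms(3)] L2_ip_def k_def mult.commute)
  obtain ip0 where H0: "rkhs ?X (?V ` chi_span \<sigma> T) ip0 ?K"
    and norm0: "\<And>f. f \<in> chi_span \<sigma> T \<Longrightarrow> ip_norm ip0 (?V f) = L2_norm ?M f"
    using feature_map_rkhs[of ?X k ?M] k_L2 unfolding span V K by blast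
  have image: "?V ` chi_span \<sigma> T = {?V f | f. f \<in> chi_span \<sigma> T}" by blast
  have unique: "H = {?V f | f. f \<in> chi_span \<sigma> T} \<and> (\<forall>f\<in>chi_span \<sigma> T. ip_norm ip (?V f) = L2_norm ?M f)"
    if "rkhs ?X H ip ?K" for H ip
  proof (intro conjI ballI)
    show "H = {?V f | f. f \<in> chi_span \<sigma> T}"
      using rkhs_unique(1)[OF H0 that] unfolding image by (rule sym)
    fix f assume f: "f \<in> chi_span \<sigma> T"
    then have "ip_norm ip0 (?V f) = ip_norm ip (?V f)"
      by (intro rkhs_unique(2)[OF H0 that]) (rule imageI)
    with norm0[OF f] show "ip_norm ip (?V f) = L2_norm ?M f" by simp
  qed
  have distributions: "defines_tempered_distribution lborel (chi_transform \<sigma> f) \<and>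
       defines_tempered_distribution ?M f \<and>
       (\<forall>\<phi>\<in>schwartz. dist_deriv (dist_of lborel (chi_transform \<sigma> f)) \<phi> =
          2 * of_real pi * dist_inv_fourier (dist_of ?M f) \<phi>)" if "f \<in> chi_span \<sigma> T" for f
  proof -
    have f: "f \<in> L2_space ?M"
      using that L2_closed_span_subset unfolding chi_span_def by blast
    note facts = sf sets_M assms(3) f
    show ?thesis
      unfolding chi_transform_def[abs_def]
      using chi_transform_defines[OF facts] L2_defines[OF facts(2-4)] chi_transform_deriv[OF facts] by blast
  qed
  show ?thesis
    using H0 unique distributions by blast
qed

end
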